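(* Let $T$ be a nondegenerate Euclidean triangle, and let $m(T)$ be the least number of faces of a convex polyhedron in $\mathbb{R}^3$ all of whose faces are congruent to $T$. Then \[ m(T)= \begin{cases} 4, & \text{if } T \text{ is acute},\\ 6, & \text{if } T \text{ is isosceles with side lengths } (\lambda,\lambda,\beta) \text{ and } \lambda\sqrt{2}\le \beta<\lambda\sqrt{3},\\ 8, & \text{otherwise.} \end{cases} \] The three cases are exhaustive and mutually exclusive: an isosceles triangle with side lengths $(\lambda,\lambda,\beta)$ is acute exactly when $\beta<\lambda\sqrt{2}$, and the third case consists of the right and obtuse scalene triangles together with the isosceles triangles with side lengths $(\lambda,\lambda,\beta)$ satisfying $\lambda\sqrt{3}\le\beta<2\lambda$.
   Context: A convex polyhedron is a three-dimensional convex polytope in $\mathbb{R}^3$ (the convex hull of finitely many points, with nonempty interior); its faces are its two-dimensional faces (facets), so distinct faces lie in distinct planes. Congruence means ordinary Euclidean congruence, including orientation-reversing isometries (reflected copies are allowed); thus a triangular face is congruent to $T$ if and only if it has the same three side lengths, with multiplicity, as $T$. The number $m(T)$ is defined for every nondegenerate triangle $T$, because for every such $T$ there is a convex polyhedron with exactly eight faces, each congruent to $T$. A triangle is acute if all its angles are strictly less than $\pi/2$; isosceles triangles include equilateral ones. *)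

theory Defs
  imports "HOL-Analysis.Analysis"
begin

text \<open>A triangle is given by its three vertices in \<open>real^3\<close>; as a point set it is their convex hull.
  Nondegeneracy (\<open>\<not> collinear {a, b, c}\<close>) is assumed where needed, not built in.\<close>

definition angle_at :: "real^3 \<Rightarrow> real^3 \<Rightarrow> real^3 \<Rightarrow> real" where
  "angle_at v p q = arccos (((p - v) \<bullet> (q - v)) / (norm (p - v) * norm (q - v)))"

definition triangle_angles :: "real^3 \<Rightarrow> real^3 \<Rightarrow> real^3 \<Rightarrow> real set" where
  "triangle_angles a b c = {angle_at a b c, angle_at b c a, angle_at c a b}"

definition triangle_sides :: "real^3 \<Rightarrow> real^3 \<Rightarrow> real^3 \<Rightarrow> real multiset" where
  "triangle_sides a b c = {#dist a b, dist b c, dist c a#}"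

definition acute_triangle :: "real^3 \<Rightarrow> real^3 \<Rightarrow> real^3 \<Rightarrow> bool" where
  "acute_triangle a b c \<longleftrightarrow> (\<forall>\<theta>\<in>triangle_angles a b c. \<theta> < pi / 2)"

definition right_triangle :: "real^3 \<Rightarrow> real^3 \<Rightarrow> real^3 \<Rightarrow> bool" where
  "right_triangle a b c \<longleftrightarrow> (\<exists>\<theta>\<in>triangle_angles a b c. \<theta> = pi / 2)"

definition obtuse_triangle :: "real^3 \<Rightarrow> real^3 \<Rightarrow> real^3 \<Rightarrow> bool" where
  "obtuse_triangle a b c \<longleftrightarrow> (\<exists>\<theta>\<in>triangle_angles a b c. \<theta> > pi / 2)"

definition scalene_triangle :: "real^3 \<Rightarrow> real^3 \<Rightarrow> real^3 \<Rightarrow> bool" where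
  "scalene_triangle a b c \<longleftrightarrow>
     dist a b \<noteq> dist b c \<and> dist b c \<noteq> dist c a \<and> dist c a \<noteq> dist a b"

text \<open>The case \<open>l = \<beta>\<close> (equilateral) is allowed.\<close>

definition isosceles_with_sides :: "real \<Rightarrow> real \<Rightarrow> real^3 \<Rightarrow> real^3 \<Rightarrow> real^3 \<Rightarrow> bool" where
  "isosceles_with_sides l \<beta> a b c \<longleftrightarrow> triangle_sides a b c = {#l, l, \<beta>#}"

text \<open>The map \<open>g\<close> is an isometry of the whole space (automatically surjective), possibly
  orientation-reversing.\<close>

definition euclidean_congruent :: "(real^3) set \<Rightarrow> (real^3) set \<Rightarrow> bool" where
  "euclidean_congruent S S' \<longleftrightarrow>
     (\<exists>g :: real^3 \<Rightarrow> real^3. (\<forall>x y. dist (g x) (g y) = dist x y) \<and> g ` S = S')"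

text \<open>In the library, \<open>polyhedron\<close> means a possibly unbounded intersection of half-spaces; a convex
  polyhedron in the present sense is a full-dimensional \<open>polytope\<close>.\<close>

definition convex_polyhedron :: "(real^3) set \<Rightarrow> bool" where
  "convex_polyhedron P \<longleftrightarrow> polytope P \<and> interior P \<noteq> {}"

definition monohedral_with :: "(real^3) set \<Rightarrow> (real^3) set \<Rightarrow> bool" where
  "monohedral_with T P \<longleftrightarrow>
     convex_polyhedron P \<and> (\<forall>F. F facet_of P \<longrightarrow> euclidean_congruent F T)"

definition face_counts :: "(real^3) set \<Rightarrow> nat set" where
  "face_counts T = {card {F. F facet_of P} | P. monohedral_with T P}"

text \<open>Meaningful only when \<open>face_counts T \<noteq> {}\<close>.\<close>

definition min_faces :: "(real^3) set \<Rightarrow> nat" where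
  "min_faces T = (LEAST n. n \<in> face_counts T)"

definition six_face_case :: "real^3 \<Rightarrow> real^3 \<Rightarrow> real^3 \<Rightarrow> bool" where
  "six_face_case a b c \<longleftrightarrow>
     (\<exists>l \<beta>. isosceles_with_sides l \<beta> a b c \<and> l * sqrt 2 \<le> \<beta> \<and> \<beta> < l * sqrt 3)"

end

theory Submission
  imports Defs
begin

text \<open>
  Upper bounds come from three explicit families. An acute triangle is the face of a tetrahedron
  inscribed in a box on alternating vertices, whose opposite edges are the two diagonals of
  opposite sides of the box (\<open>four_face_disphenoid\<close>). An isosceles triangle whose base is less than
  \<open>sqrt 3\<close> times its legs is the face of a bipyramid over an equilateral triangle
  (\<open>six_face_bipyramid\<close>): the condition says that the legs exceed the circumradius of that base.
  Every triangle is the face of a tetragonal scalenohedron (\<open>eight_face_scalenohedron\<close>), an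
  octahedron whose equator zigzags up and down; the three parameters of this family
  (radius, height, size of the zigzag) can be solved for the three side lengths, and Heron's formula is
  exactly the condition that the radius is positive.

  The lower bounds rest on the observation that one vertex of degree three nearly determines the
  shape of the face. Let three faces \<open>v x y\<close>, \<open>v y z\<close>, \<open>v z x\<close> meet at \<open>v\<close>. Consecutive faces share
  an edge at \<open>v\<close>, so equality of the side multisets leaves only two possibilities
  (\<open>corner_sides_cases\<close>): either opposite edges of the tetrahedron \<open>v x y z\<close> are equal, and then its faces are
  acute because it is not flat (\<open>disphenoid_face_acute\<close>), or \<open>x y z\<close> is equilateral and \<open>v\<close>
  is equidistant from its vertices, and then the base of the isosceles face is less than \<open>sqrt 3\<close> times
  its legs (\<open>equilateral_pyramid_bound\<close>).

  It remains to find such a vertex when there are at most seven faces, and this is a count. Every edge lies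
  on exactly two faces, so the number of faces at a vertex is the number of its neighbours. If every
  vertex had degree at least four, then \<open>3 F \<ge> 4 V\<close> with \<open>F \<le> 7\<close> would give \<open>V \<le> 5\<close>; as each
  vertex has at least four neighbours, \<open>V = 5\<close> and all degrees are four, but \<open>3 F = 20\<close> is impossible. If there are at most
  five faces, then \<open>x y z\<close> must be a face too (\<open>five_triangles_close_up\<close>), the equilateral
  alternative collapses to a regular tetrahedron, and the face is acute.
\<close>

section \<open>Triangles and their side lengths\<close>

lemma dot_via_dists:
  fixes a b c :: "'a::real_inner"
  shows "2 * ((b - a) \<bullet> (c - a)) = (dist a b)\<^sup>2 + (dist c a)\<^sup>2 - (dist b c)\<^sup>2"
  by (simp add: dist_norm power2_norm_eq_inner inner_diff_left inner_diff_right inner_commute)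

lemma angle_at_less_right_angle_iff:
  assumes "p \<noteq> v" "q \<noteq> v"
  shows "angle_at v p q < pi / 2 \<longleftrightarrow> 0 < (p - v) \<bullet> (q - v)"
proof -
  define t where "t = ((p - v) \<bullet> (q - v)) / (norm (p - v) * norm (q - v))"
  have pos: "0 < norm (p - v) * norm (q - v)" using assms by simp
  have "\<bar>t\<bar> \<le> 1"
    unfolding t_def using Cauchy_Schwarz_ineq2[of "p - v" "q - v"] pos by (simp add: abs_mult)
  then have t: "-1 \<le> t" "t \<le> 1" by auto
  have half: "arccos 0 = pi / 2" by simp
  have "arccos t < pi / 2 \<longleftrightarrow> 0 < t"
    unfolding half[symmetric] using arccos_less_mono[of t 0] t by auto
  moreover have "0 < t \<longleftrightarrow> 0 < (p - v) \<bullet> (q - v)"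
    unfolding t_def using pos by (auto simp: zero_less_divide_iff)
  ultimately show ?thesis
    by (simp add: angle_at_def t_def)
qed

lemma acute_triangle_iff:
  assumes "\<not> collinear {a, b, c}"
  shows "acute_triangle a b c \<longleftrightarrow>
    (dist a b)\<^sup>2 < (dist b c)\<^sup>2 + (dist c a)\<^sup>2 \<and>
    (dist b c)\<^sup>2 < (dist c a)\<^sup>2 + (dist a b)\<^sup>2 \<and>
    (dist c a)\<^sup>2 < (dist a b)\<^sup>2 + (dist b c)\<^sup>2"
proof -
  have "a \<noteq> b" "b \<noteq> c" "c \<noteq> a" using assms by (auto simp: insert_commute)
  then show ?thesis
    unfolding acute_triangle_def triangle_angles_def
    using angle_at_less_right_angle_iff[of b a c] angle_at_less_right_angle_iff[of c b a]
      angle_at_less_right_angle_iff[of a c b]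
      dot_via_dists[of b a c] dot_via_dists[of c b a] dot_via_dists[of a c b]
    by auto
qed

lemma not_acute_iff_right_or_obtuse:
  assumes "\<not> collinear {a, b, c}"
  shows "\<not> acute_triangle a b c \<longleftrightarrow> right_triangle a b c \<or> obtuse_triangle a b c"
  unfolding acute_triangle_def right_triangle_def obtuse_triangle_def
  by (metis linorder_not_less order.strict_iff_order order.asym)

text \<open>The quantity \<open>h\<close> is 16 times the squared area by Heron's formula, and it equals four times the
  defect in the Cauchy-Schwarz inequality for two side vectors.\<close>
lemma collinear_iff_heron:
  fixes a b c :: "'a::euclidean_space"
  defines "h \<equiv> 2 * ((dist a b)\<^sup>2 * (dist b c)\<^sup>2 + (dist b c)\<^sup>2 * (dist c a)\<^sup>2 + (dist c a)\<^sup>2 * (dist a b)\<^sup>2)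
    - (dist a b) ^ 4 - (dist b c) ^ 4 - (dist c a) ^ 4"
  shows "0 \<le> h" and "collinear {a, b, c} \<longleftrightarrow> h = 0"
proof -
  let ?u = "a - b" and ?v = "c - b"
  have "2 * (?u \<bullet> ?v) = (dist b a)\<^sup>2 + (dist c b)\<^sup>2 - (dist a c)\<^sup>2"
    by (rule dot_via_dists)
  then have "(2 * (?u \<bullet> ?v))\<^sup>2 = ((dist a b)\<^sup>2 + (dist b c)\<^sup>2 - (dist c a)\<^sup>2)\<^sup>2"
    by (simp add: dist_commute)
  moreover have "(norm ?u)\<^sup>2 = (dist a b)\<^sup>2" "(norm ?v)\<^sup>2 = (dist b c)\<^sup>2"
    by (simp_all add: dist_norm norm_minus_commute)
  ultimately have h: "h = 4 * ((norm ?u * norm ?v)\<^sup>2 - (\<bar>?u \<bullet> ?v\<bar>)\<^sup>2)"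
    unfolding h_def power_mult_distrib power2_abs by algebra
  show "0 \<le> h"
    unfolding h using power_mono[OF Cauchy_Schwarz_ineq2[of ?u ?v], of 2] by simp
  have "collinear {a, b, c} \<longleftrightarrow> collinear {0, ?u, ?v}"
    by (subst collinear_3) (auto simp: NO_MATCH_def)
  also have "\<dots> \<longleftrightarrow> \<bar>?u \<bullet> ?v\<bar> = norm ?u * norm ?v"
    by (rule norm_cauchy_schwarz_equal[symmetric])
  also have "\<dots> \<longleftrightarrow> h = 0"
    unfolding h using power2_eq_iff_nonneg[of "norm ?u * norm ?v" "\<bar>?u \<bullet> ?v\<bar>"] by auto
  finally show "collinear {a, b, c} \<longleftrightarrow> h = 0" .
qed

lemma mset_two_eq_iff: "{#q, r#} = {#y, z#} \<longleftrightarrow> q = y \<and> r = z \<or> q = z \<and> r = y"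
  by (auto simp: add_eq_conv_ex)

lemma mset_three_eq_iff:
  "{#p, q, r#} = {#x, y, z#} \<longleftrightarrow>
    p = x \<and> q = y \<and> r = z \<or> p = x \<and> q = z \<and> r = y \<or> p = y \<and> q = x \<and> r = z \<or>
    p = y \<and> q = z \<and> r = x \<or> p = z \<and> q = x \<and> r = y \<or> p = z \<and> q = y \<and> r = x"
    (is "?lhs \<longleftrightarrow> ?rhs")
proof
  assume ?lhs
  then have "p \<in># {#x, y, z#}"
    by (metis union_single_eq_member)
  then consider "p = x" | "p = y" | "p = z"
    by auto
  then show ?rhs
  proof cases
    case 1
    then have "{#q, r#} = {#y, z#}" using \<open>?lhs\<close> by simp
    with 1 show ?thesis by (auto simp: mset_two_eq_iff)
  next
    case 2
    then have "add_mset y {#q, r#} = add_mset y {#x, z#}"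
      using \<open>?lhs\<close> by (simp add: add_mset_commute)
    then have "{#q, r#} = {#x, z#}" by simp
    with 2 show ?thesis by (auto simp: mset_two_eq_iff)
  next
    case 3
    then have "add_mset z {#q, r#} = add_mset z {#x, y#}"
      using \<open>?lhs\<close> by (simp add: add_mset_commute)
    then have "{#q, r#} = {#x, y#}" by simp
    with 3 show ?thesis by (auto simp: mset_two_eq_iff)
  qed
next
  assume ?rhs
  then show ?lhs
    by (elim disjE) (simp_all add: add_mset_commute)
qed

text \<open>Relabelling the vertices of one triangle turns equality of the multisets of sides into equality of
  corresponding sides, and its convex hull does not notice the relabelling.\<close>
lemma triangle_sides_eq_cases:
  assumes "triangle_sides x y z = triangle_sides a b c"
  obtains a' b' c' where "{a', b', c'} = {a, b, c}"
    "dist a' b' = dist x y" "dist b' c' = dist y z" "dist c' a' = dist z x"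
proof -
  have "{#dist x y, dist y z, dist z x#} = {#dist a b, dist b c, dist c a#}"
    using assms by (simp add: triangle_sides_def)
  then consider
      "dist x y = dist a b" "dist y z = dist b c" "dist z x = dist c a"
    | "dist x y = dist a b" "dist y z = dist c a" "dist z x = dist b c"
    | "dist x y = dist b c" "dist y z = dist a b" "dist z x = dist c a"
    | "dist x y = dist b c" "dist y z = dist c a" "dist z x = dist a b"
    | "dist x y = dist c a" "dist y z = dist a b" "dist z x = dist b c"
    | "dist x y = dist c a" "dist y z = dist b c" "dist z x = dist a b"
    unfolding mset_three_eq_iff by blast
  then show ?thesis
  proof cases
    case 1 then show ?thesis using that[of a b c] by simp
  next
    case 2 then show ?thesis using that[of b a c] by (simp add: dist_commute insert_commute)
  next
    case 3 then show ?thesis using that[of c b a] by (simp add: dist_commute insert_commute)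
  next
    case 4 then show ?thesis using that[of b c a] by (simp add: dist_commute insert_commute)
  next
    case 5 then show ?thesis using that[of c a b] by (simp add: dist_commute insert_commute)
  next
    case 6 then show ?thesis using that[of a c b] by (simp add: dist_commute insert_commute)
  qed
qed

lemma triangle_sides_insert_eq:
  assumes "{x, y, z} = {a, b, c}" "x \<noteq> y" "y \<noteq> z" "x \<noteq> z"
  shows "triangle_sides x y z = triangle_sides a b c"
proof -
  have "(x = a \<and> y = b \<and> z = c) \<or> (x = a \<and> y = c \<and> z = b) \<or> (x = b \<and> y = a \<and> z = c) \<or>
      (x = b \<and> y = c \<and> z = a) \<or> (x = c \<and> y = a \<and> z = b) \<or> (x = c \<and> y = b \<and> z = a)"
  proof -
    have "x \<in> {a, b, c}" "y \<in> {a, b, c}" "z \<in> {a, b, c}"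
      using assms(1) by blast+
    then show ?thesis using assms(2-4) by auto
  qed
  then show ?thesis
    by (elim disjE) (simp_all add: triangle_sides_def dist_commute add_mset_commute)
qed

lemma noncollinear_triangle_sides:
  assumes "triangle_sides x y z = triangle_sides a b c" "\<not> collinear {a, b, c}"
  shows "\<not> collinear {x, y, z}"
proof -
  obtain a' b' c' where 1: "{a', b', c'} = {a, b, c}"
    and 2: "dist a' b' = dist x y" "dist b' c' = dist y z" "dist c' a' = dist z x"
    using triangle_sides_eq_cases[OF assms(1)] .
  then show ?thesis
    using assms(2) unfolding 1[symmetric] collinear_iff_heron(2) 2 by simp
qed

text \<open>The reflection in the perpendicular bisector of \<open>p\<close> and \<open>q\<close>. That it fixes every point
  equidistant from the two is what allows several such reflections to be composed.\<close>
lemma reflection_swapping: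
  fixes p q :: "'a::real_inner"
  obtains g :: "'a \<Rightarrow> 'a" where "\<And>x y. dist (g x) (g y) = dist x y" "g p = q"
    "\<And>x. dist x p = dist x q \<Longrightarrow> g x = x"
proof (cases "p = q")
  case True
  then show ?thesis using that[of "\<lambda>x. x"] by simp
next
  case False
  define w where "w = p - q"
  define m where "m = (1/2) *\<^sub>R (p + q)"
  have w: "w \<bullet> w \<noteq> 0" using False by (simp add: w_def)
  have square: "(norm (u - k *\<^sub>R w))\<^sup>2 = (norm u)\<^sup>2 - 2 * k * (u \<bullet> w) + k * (k * (w \<bullet> w))" for u k
    by (simp add: power2_norm_eq_inner inner_diff_left inner_diff_right inner_commute algebra_simps)
  define g where "g x = x - (2 * ((x - m) \<bullet> w) / (w \<bullet> w)) *\<^sub>R w" for x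
  show ?thesis
  proof (rule that[of g])
    fix x y
    define k where "k = 2 * ((x - y) \<bullet> w) / (w \<bullet> w)"
    have k: "k * (w \<bullet> w) = 2 * ((x - y) \<bullet> w)" using w by (simp add: k_def)
    have "g x - g y = (x - y) - k *\<^sub>R w"
      by (simp add: g_def k_def inner_diff_left scaleR_diff_left diff_divide_distrib right_diff_distrib algebra_simps)
    then have "(norm (g x - g y))\<^sup>2 = (norm (x - y))\<^sup>2"
      by (simp only: square k)
    then show "dist (g x) (g y) = dist x y"
      by (simp add: dist_norm)
  next
    have "p - m = p - (1/2) *\<^sub>R p - (1/2) *\<^sub>R q"
      by (simp add: m_def scaleR_add_right)
    also have "p - (1/2) *\<^sub>R p = (1/2) *\<^sub>R p"
      using scaleR_left_diff_distrib[of 1 "1/2" p] by simp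
    finally have "p - m = (1/2) *\<^sub>R w"
      by (simp add: w_def scaleR_diff_right)
    then show "g p = q" using w by (simp add: g_def w_def)
  next
    fix x assume "dist x p = dist x q"
    then have "(norm (x - p))\<^sup>2 = (norm (x - q))\<^sup>2" by (simp add: dist_norm)
    then have "(x - m) \<bullet> w = 0"
      by (simp add: power2_norm_eq_inner m_def w_def inner_diff_left inner_diff_right inner_add_left inner_commute algebra_simps)
    then show "g x = x" by (simp add: g_def)
  qed
qed

text \<open>Side-side-side, extended to the whole space: each of three reflections puts one more vertex in
  place, and fixes the vertices placed before because the corresponding distances already agree.\<close>
lemma isometry_between_congruent_triangles:
  fixes x y z a b c :: "'a::real_inner"
  assumes "dist a b = dist x y" "dist b c = dist y z" "dist c a = dist z x"
  obtains g :: "'a \<Rightarrow> 'a" where "\<And>u v. dist (g u) (g v) = dist u v" "g x = a" "g y = b" "g z = c"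
proof -
  obtain f where f: "\<And>u v. dist (f u) (f v) = dist u v" "f x = a"
    using reflection_swapping[of x a] by metis
  obtain g where g: "\<And>u v. dist (g u) (g v) = dist u v" "g (f y) = b"
      "\<And>u. dist u (f y) = dist u b \<Longrightarrow> g u = u"
    using reflection_swapping[of "f y" b] by metis
  have "dist a (f y) = dist a b"
    using f(1)[of x y] f(2) assms(1) by simp
  then have ga: "g a = a" by (rule g(3))
  obtain h where h: "\<And>u v. dist (h u) (h v) = dist u v" "h (g (f z)) = c"
      "\<And>u. dist u (g (f z)) = dist u c \<Longrightarrow> h u = u"
    using reflection_swapping[of "g (f z)" c] by metis
  have "dist a (g (f z)) = dist a c" "dist b (g (f z)) = dist b c"
    using g(1)[of a "f z"] g(1)[of "f y" "f z"] f(1)[of x z] f(1)[of y z] f(2) g(2) ga assms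
    by (simp_all add: dist_commute)
  then have "h a = a" "h b = b" by (simp_all add: h(3))
  then show ?thesis
    using that[of "\<lambda>u. h (g (f u))"] f g(1,2) h(1,2) ga by simp
qed

lemma isometry_convex_hull:
  fixes g :: "'a::euclidean_space \<Rightarrow> 'a"
  assumes "\<And>x y. dist (g x) (g y) = dist x y"
  shows "g ` (convex hull S) = convex hull (g ` S)"
proof -
  define f where "f x = g x - g 0" for x
  have "orthogonal_transformation f"
    unfolding orthogonal_transformation_isometry using assms by (simp add: f_def dist_norm)
  then have lin: "linear f" by (simp add: orthogonal_transformation_def)
  have g: "g ` A = (\<lambda>x. g 0 + x) ` (f ` A)" for A
    by (auto simp: f_def image_image)
  show ?thesis
    unfolding g convex_hull_translation using convex_hull_linear_image[OF lin] by simp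
qed

lemma isometry_inverse:
  fixes g :: "'a::euclidean_space \<Rightarrow> 'a"
  assumes "\<And>x y. dist (g x) (g y) = dist x y"
  obtains h where "\<And>x y. dist (h x) (h y) = dist x y" "\<And>x. h (g x) = x"
proof -
  define f where "f x = g x - g 0" for x
  have "orthogonal_transformation f"
    unfolding orthogonal_transformation_isometry using assms by (simp add: f_def dist_norm)
  then obtain f' where f': "orthogonal_transformation f'" "\<And>x. f' (f x) = x"
    by (metis orthogonal_transformation_inj orthogonal_transformation_inv inv_f_f)
  have "dist (f' x) (f' y) = dist x y" for x y
    using f' by (simp add: orthogonal_transformation_isometry)
  then show ?thesis
    using that[of "\<lambda>x. f' (x - g 0)"] f' by (simp add: f_def dist_norm)
qed

lemma congruent_triangleI:
  assumes "triangle_sides x y z = triangle_sides a b c"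
  shows "euclidean_congruent (convex hull {x, y, z}) (convex hull {a, b, c})"
proof -
  obtain a' b' c' where 1: "{a', b', c'} = {a, b, c}"
    and 2: "dist a' b' = dist x y" "dist b' c' = dist y z" "dist c' a' = dist z x"
    using triangle_sides_eq_cases[OF assms] .
  obtain g :: "real^3 \<Rightarrow> real^3" where g: "\<And>u v. dist (g u) (g v) = dist u v" "g x = a'" "g y = b'" "g z = c'"
    using isometry_between_congruent_triangles[OF 2] by metis
  then show ?thesis
    unfolding euclidean_congruent_def using isometry_convex_hull[of g "{x, y, z}"] 1 by auto
qed

text \<open>Pulling the vertices of the given triangle back along the isometry makes every facet of a
  monohedral polyhedron the convex hull of three points with prescribed distances.\<close>
lemma congruent_triangleE:
  assumes "euclidean_congruent F (convex hull {a, b, c})"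
  obtains x y z where "F = convex hull {x, y, z}" "triangle_sides x y z = triangle_sides a b c"
proof -
  obtain g where g: "\<And>x y. dist (g x) (g y) = dist x y" "g ` F = convex hull {a, b, c}"
    using assms by (auto simp: euclidean_congruent_def)
  obtain h where h: "\<And>x y. dist (h x) (h y) = dist x y" "\<And>x. h (g x) = x"
    using isometry_inverse[of g] g(1) by metis
  have "F = h ` (g ` F)"
    by (simp add: image_image h)
  also have "\<dots> = convex hull {h a, h b, h c}"
    unfolding g(2) using isometry_convex_hull[of h "{a, b, c}"] h(1) by simp
  finally show ?thesis
    using that h(1) by (simp add: triangle_sides_def)
qed

section \<open>Closed pseudosurfaces with few triangles\<close>

text \<open>The combinatorial trace of a convex polyhedron with triangular facets: \<open>\<F>\<close> consists of the
  vertex triples of the facets, and \<open>card_edge\<close> says that each edge borders exactly two of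
  them. For few triangles, counting incidences here takes the place of Euler's formula.\<close>

locale closed_pseudosurface =
  fixes \<F> :: "'a set set"
  assumes finite_triangles: "finite \<F>"
    and nonempty: "\<F> \<noteq> {}"
    and card_triangle: "t \<in> \<F> \<Longrightarrow> card t = 3"
    and card_edge: "t \<in> \<F> \<Longrightarrow> x \<in> t \<Longrightarrow> y \<in> t \<Longrightarrow> x \<noteq> y \<Longrightarrow> card {u \<in> \<F>. x \<in> u \<and> y \<in> u} = 2"
begin

lemma triangle_distinct:
  assumes "{x, y, z} \<in> \<F>"
  shows "x \<noteq> y" "y \<noteq> z" "x \<noteq> z"
  using card_triangle[OF assms] by (auto simp: card_insert_if split: if_splits)

lemma triangle_through_edge:
  assumes "u \<in> \<F>" "x \<in> u" "y \<in> u" "x \<noteq> y"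
  obtains p where "u = {x, y, p}" "p \<noteq> x" "p \<noteq> y"
proof -
  have "card (u - {x, y}) = 1"
    using card_triangle[OF assms(1)] assms by (subst card_Diff_subset) auto
  then obtain p where "u - {x, y} = {p}"
    by (auto simp: card_1_singleton_iff)
  with that[of p] assms show ?thesis by blast
qed

lemma neighbour_across_edge:
  assumes "{x, y, z} \<in> \<F>"
  obtains p where "{x, y, p} \<in> \<F>" "p \<noteq> x" "p \<noteq> y" "p \<noteq> z"
proof -
  have "card {u \<in> \<F>. x \<in> u \<and> y \<in> u} = 2"
    using card_edge[OF assms] triangle_distinct[OF assms] by blast
  then obtain u v where "{u \<in> \<F>. x \<in> u \<and> y \<in> u} = {u, v}" "u \<noteq> v"
    by (auto simp: card_2_iff)
  then obtain u where u: "u \<in> \<F>" "x \<in> u" "y \<in> u" "u \<noteq> {x, y, z}"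
    by blast
  then show ?thesis
    using triangle_through_edge[OF u(1-3)] triangle_distinct[OF assms] that by metis
qed

text \<open>A triangle and its three neighbours across its edges; no two neighbours coincide, since a triangle
  containing two edges of the first one is the first one.\<close>
lemma at_least_four: "4 \<le> card \<F>"
proof -
  obtain t where t: "t \<in> \<F>" using nonempty by blast
  then obtain x y z where "t = {x, y, z}"
    using card_triangle[OF t] by (auto simp: card_3_iff)
  with t have xyz: "{x, y, z} \<in> \<F>" "{y, z, x} \<in> \<F>" "{z, x, y} \<in> \<F>"
    by (simp_all add: insert_commute)
  note d = triangle_distinct[OF xyz(1)]
  obtain p where p: "{x, y, p} \<in> \<F>" "p \<noteq> x" "p \<noteq> y" "p \<noteq> z"
    using neighbour_across_edge[OF xyz(1)] .
  obtain q where q: "{y, z, q} \<in> \<F>" "q \<noteq> y" "q \<noteq> z" "q \<noteq> x"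
    using neighbour_across_edge[OF xyz(2)] .
  obtain r where r: "{z, x, r} \<in> \<F>" "r \<noteq> z" "r \<noteq> x" "r \<noteq> y"
    using neighbour_across_edge[OF xyz(3)] .
  have "p \<notin> {x, y, z}" "z \<notin> {x, y, p}" "q \<notin> {x, y, z}" "x \<notin> {y, z, q}" "r \<notin> {x, y, z}"
    using d p q r by auto
  then have "{x, y, z} \<noteq> {x, y, p}" "{x, y, z} \<noteq> {y, z, q}" "{x, y, z} \<noteq> {z, x, r}"
    "{x, y, p} \<noteq> {y, z, q}" "{x, y, p} \<noteq> {z, x, r}" "{y, z, q} \<noteq> {z, x, r}"
    by blast+
  then have "card {{x, y, z}, {x, y, p}, {y, z, q}, {z, x, r}} = 4"
    by (simp only: card_insert_if finite.intros) simp
  then show ?thesis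
    using card_mono[OF finite_triangles, of "{{x, y, z}, {x, y, p}, {y, z, q}, {z, x, r}}"] xyz p q r
    by simp
qed

text \<open>Crossing the edges \<open>v x\<close> and \<open>v y\<close> of a triangle \<open>v x y\<close> yields two further triangles
  \<open>v x p\<close> and \<open>v y q\<close>. If these are all triangles at \<open>v\<close>, the one beyond the edge \<open>v p\<close> can only be
  \<open>v y q\<close>, which forces \<open>p = q\<close>.\<close>
lemma degree_three_vertex:
  assumes v: "v \<in> \<Union>\<F>" and deg: "card {t \<in> \<F>. v \<in> t} \<le> 3"
  obtains x y z where "{v, x, y} \<in> \<F>" "{v, y, z} \<in> \<F>" "{v, z, x} \<in> \<F>" "z \<noteq> x"
proof -
  obtain t where t: "t \<in> \<F>" "v \<in> t" using v by blast
  then obtain a b c where abc: "t = {a, b, c}"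
    using card_triangle[OF t(1)] by (auto simp: card_3_iff)
  have "\<exists>x y. t = {v, x, y}"
    using t(2) unfolding abc by blast
  then obtain x y where "t = {v, x, y}" by blast
  with t have vxy: "{v, x, y} \<in> \<F>" "{v, y, x} \<in> \<F>"
    by (simp_all add: insert_commute)
  note d = triangle_distinct[OF vxy(1)]
  obtain p where p: "{v, x, p} \<in> \<F>" "p \<noteq> v" "p \<noteq> x" "p \<noteq> y"
    using neighbour_across_edge[OF vxy(1)] .
  obtain q where q: "{v, y, q} \<in> \<F>" "q \<noteq> v" "q \<noteq> y" "q \<noteq> x"
    using neighbour_across_edge[OF vxy(2)] .
  have "{v, p, x} \<in> \<F>" using p by (simp add: insert_commute)
  then obtain s where s: "{v, p, s} \<in> \<F>" "s \<noteq> v" "s \<noteq> p" "s \<noteq> x"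
    by (rule neighbour_across_edge)
  have notin: "p \<notin> {v, x, y}" "x \<notin> {v, y, q}" "q \<notin> {v, x, y}" "s \<notin> {v, x, p}"
    using d p q s by auto
  then have "{v, x, y} \<noteq> {v, x, p}" "{v, x, y} \<noteq> {v, y, q}" "{v, x, p} \<noteq> {v, y, q}"
    by blast+
  then have "card {{v, x, y}, {v, x, p}, {v, y, q}} = 3"
    by (simp only: card_insert_if finite.intros) simp
  then have star: "{{v, x, y}, {v, x, p}, {v, y, q}} = {t \<in> \<F>. v \<in> t}"
    using vxy p q deg finite_triangles by (intro card_seteq) auto
  have "{v, p, s} \<in> {{v, x, y}, {v, x, p}, {v, y, q}}"
    unfolding star using s by simp
  moreover have "{v, p, s} \<noteq> {v, x, y}" "{v, p, s} \<noteq> {v, x, p}"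
    using notin by blast+
  ultimately have "{v, p, s} = {v, y, q}"
    by simp
  then have "p \<in> {v, y, q}"
    by blast
  then have "p = q"
    using p by simp
  then show ?thesis
    using that[of x y p] vxy p q by (simp add: insert_commute)
qed

text \<open>Count the pairs of a triangle at \<open>v\<close> and another vertex of it: each triangle has two such
  vertices, and each neighbour lies on at most two triangles at \<open>v\<close>.\<close>
lemma degree_le_neighbours:
  assumes v: "v \<in> \<Union>\<F>"
  shows "card {t \<in> \<F>. v \<in> t} \<le> card (\<Union>\<F> - {v})"
proof -
  have fin: "finite (\<Union>\<F>)"
    using finite_triangles card_triangle by (metis card.infinite finite_Union zero_neq_numeral)
  have "(\<Sum>t\<in>{t \<in> \<F>. v \<in> t}. card {x \<in> \<Union>\<F> - {v}. x \<in> t}) =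
        (\<Sum>x\<in>\<Union>\<F> - {v}. card {t \<in> {t \<in> \<F>. v \<in> t}. x \<in> t})"
    using fin finite_triangles by (intro sum_multicount_gen) auto
  moreover have "card {x \<in> \<Union>\<F> - {v}. x \<in> t} = 2" if "t \<in> {t \<in> \<F>. v \<in> t}" for t
  proof -
    have "{x \<in> \<Union>\<F> - {v}. x \<in> t} = t - {v}" using that by blast
    then show ?thesis using that card_triangle by simp
  qed
  moreover have "card {t \<in> {t \<in> \<F>. v \<in> t}. x \<in> t} \<le> 2" if "x \<in> \<Union>\<F> - {v}" for x
  proof (cases "\<exists>t\<in>\<F>. v \<in> t \<and> x \<in> t")
    case True
    then show ?thesis using card_edge[of _ v x] that by fastforce
  next
    case False
    then have "{t \<in> {t \<in> \<F>. v \<in> t}. x \<in> t} = {}" by blast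
    then show ?thesis by (simp only: card.empty)
  qed
  ultimately have "2 * card {t \<in> \<F>. v \<in> t} \<le> 2 * card (\<Union>\<F> - {v})"
    using sum_bounded_above[of "\<Union>\<F> - {v}" "\<lambda>x. card {t \<in> {t \<in> \<F>. v \<in> t}. x \<in> t}" 2] by simp
  then show ?thesis by simp
qed

text \<open>Were all degrees at least four, then counting incidences would give at most five vertices, hence degrees
  exactly four on exactly five vertices, and three times the number of triangles would be 20.\<close>
lemma exists_vertex_of_degree_at_most_three:
  assumes "card \<F> \<le> 7"
  shows "\<exists>v\<in>\<Union>\<F>. card {t \<in> \<F>. v \<in> t} \<le> 3"
proof (rule ccontr)
  assume "\<not> ?thesis"
  then have deg: "card {t \<in> \<F>. v \<in> t} \<ge> 4" if "v \<in> \<Union>\<F>" for v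
    using that by force
  let ?V = "\<Union>\<F>"
  have fin: "finite ?V"
    using finite_triangles card_triangle by (metis card.infinite finite_Union zero_neq_numeral)
  have "card {x \<in> ?V. x \<in> t} = 3" if "t \<in> \<F>" for t
  proof -
    have "{x \<in> ?V. x \<in> t} = t" using that by blast
    then show ?thesis using card_triangle[OF that] by simp
  qed
  then have sum: "(\<Sum>v\<in>?V. card {t \<in> \<F>. v \<in> t}) = 3 * card \<F>"
    using fin finite_triangles by (intro sum_multicount) auto
  have "card ?V * 4 \<le> (\<Sum>v\<in>?V. card {t \<in> \<F>. v \<in> t})"
    using deg sum_bounded_below[of ?V 4 "\<lambda>v. card {t \<in> \<F>. v \<in> t}"] by simp
  with sum assms have V: "card ?V \<le> 5" by simp
  have tight: "card {t \<in> \<F>. v \<in> t} = 4 \<and> card ?V = 5" if "v \<in> ?V" for v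
  proof -
    have "card {t \<in> \<F>. v \<in> t} \<le> card ?V - 1"
      using degree_le_neighbours[OF that] that fin by simp
    with V deg[OF that] show ?thesis by linarith
  qed
  have "\<Union>\<F> \<noteq> {}"
  proof
    assume "\<Union>\<F> = {}"
    moreover obtain t where "t \<in> \<F>" using nonempty by blast
    ultimately have "t = {}" by blast
    then show False using card_triangle[OF \<open>t \<in> \<F>\<close>] by simp
  qed
  then obtain v where "v \<in> ?V" by (auto simp only: ex_in_conv[symmetric])
  then have five: "card ?V = 5"
    using tight[of v] by simp
  have "(\<Sum>v\<in>?V. card {t \<in> \<F>. v \<in> t}) = (\<Sum>v\<in>?V. 4)"
    by (rule sum.cong[OF refl]) (use tight in simp)
  also have "\<dots> = 20"
    by (simp add: five)
  finally have "(\<Sum>v\<in>?V. card {t \<in> \<F>. v \<in> t}) = 20" .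
  with sum have "3 * card \<F> = 20"
    by simp
  then show False by presburger
qed

text \<open>Otherwise the triangles beyond the three edges opposite to \<open>v\<close> would be three different ones not
  containing \<open>v\<close>, which makes six.\<close>
lemma five_triangles_close_up:
  assumes few: "card \<F> \<le> 5"
    and vxy: "{v, x, y} \<in> \<F>" and vyz: "{v, y, z} \<in> \<F>" and vzx: "{v, z, x} \<in> \<F>"
  shows "{x, y, z} \<in> \<F>"
proof (rule ccontr)
  assume not: "{x, y, z} \<notin> \<F>"
  have *: "{x, y, v} \<in> \<F>" "{y, z, v} \<in> \<F>" "{z, x, v} \<in> \<F>"
    using vxy vyz vzx by (simp_all add: insert_commute)
  obtain p where p: "{x, y, p} \<in> \<F>" "p \<noteq> x" "p \<noteq> y" "p \<noteq> v"
    using neighbour_across_edge[OF *(1)] .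
  obtain q where q: "{y, z, q} \<in> \<F>" "q \<noteq> y" "q \<noteq> z" "q \<noteq> v"
    using neighbour_across_edge[OF *(2)] .
  obtain r where r: "{z, x, r} \<in> \<F>" "r \<noteq> z" "r \<noteq> x" "r \<noteq> v"
    using neighbour_across_edge[OF *(3)] .
  have ne: "p \<noteq> z" "q \<noteq> x" "r \<noteq> y"
    using not p q r by (auto simp: insert_commute)
  note d = triangle_distinct[OF vxy] triangle_distinct[OF vyz] triangle_distinct[OF vzx]
  let ?star = "{{v, x, y}, {v, y, z}, {v, z, x}}" and ?rest = "{{x, y, p}, {y, z, q}, {z, x, r}}"
  have "z \<notin> {v, x, y}" "x \<notin> {v, y, z}"
    using d by auto
  then have "{v, x, y} \<noteq> {v, y, z}" "{v, x, y} \<noteq> {v, z, x}" "{v, y, z} \<noteq> {v, z, x}"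
    by blast+
  then have "card ?star = 3"
    by (simp only: card_insert_if finite.intros) simp
  moreover have "z \<notin> {x, y, p}" "x \<notin> {y, z, q}"
    using d ne by auto
  then have "{x, y, p} \<noteq> {y, z, q}" "{x, y, p} \<noteq> {z, x, r}" "{y, z, q} \<noteq> {z, x, r}"
    by blast+
  then have "card ?rest = 3"
    by (simp only: card_insert_if finite.intros) simp
  moreover have "?star \<inter> ?rest = {}"
  proof -
    have "v \<notin> {x, y, p}" "v \<notin> {y, z, q}" "v \<notin> {z, x, r}"
      using d p q r by auto
    then show ?thesis by blast
  qed
  ultimately have "card (?star \<union> ?rest) = 6"
    by (subst card_Un_disjoint) auto
  moreover have "?star \<union> ?rest \<subseteq> \<F>"
    using vxy vyz vzx p q r by blast
  ultimately have "6 \<le> card \<F>"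
    using card_mono[OF finite_triangles] by metis
  with few show False by simp
qed

end

section \<open>Facets around an edge and at a vertex\<close>

definition vertices :: "'a::real_vector set \<Rightarrow> 'a set" where
  "vertices F = {v. v extreme_point_of F}"

lemma vertices_triangle:
  fixes x y z :: "'a::euclidean_space"
  assumes "\<not> collinear {x, y, z}"
  shows "vertices (convex hull {x, y, z}) = {x, y, z}"
proof -
  have "\<not> affine_dependent {x, y, z}"
    using assms affine_dependent_imp_collinear_3 by blast
  then show ?thesis
    unfolding vertices_def using extreme_point_of_convex_hull_affine_independent by blast
qed

text \<open>Modulo the direction \<open>d\<close> of the edge, space is a plane, and the facets through the edge become
  boundary rays of a pointed cone, spanned by \<open>u1\<close>, \<open>u2\<close>, \<open>u3\<close>. A third ray would be a combination of
  the other two; the outer normals of the first two facets force both coefficients to be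
  positive, and then the normal of the third facet cannot vanish on it.\<close>
lemma no_three_facets_through_edge:
  fixes P :: "(real^3) set"
  assumes P: "polyhedron P"
    and facets: "F1 facet_of P" "F2 facet_of P" "F3 facet_of P"
    and edge: "e \<noteq> e'" "{e, e'} \<subseteq> F1 \<inter> F2 \<inter> F3"
    and w1: "w1 \<in> F1" "w1 \<notin> F2" "w1 \<notin> F3"
    and w2: "w2 \<in> F2" "w2 \<notin> F1" "w2 \<notin> F3"
    and w3: "w3 \<in> F3" "w3 \<notin> F1" "w3 \<notin> F2"
  shows False
proof -
  obtain n1 b1 where n1: "P \<subseteq> {x. n1 \<bullet> x \<le> b1}" "F1 = P \<inter> {x. n1 \<bullet> x = b1}"
    using facet_of_polyhedron[OF P facets(1)] by metis
  obtain n2 b2 where n2: "P \<subseteq> {x. n2 \<bullet> x \<le> b2}" "F2 = P \<inter> {x. n2 \<bullet> x = b2}"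
    using facet_of_polyhedron[OF P facets(2)] by metis
  obtain n3 b3 where n3: "P \<subseteq> {x. n3 \<bullet> x \<le> b3}" "F3 = P \<inter> {x. n3 \<bullet> x = b3}"
    using facet_of_polyhedron[OF P facets(3)] by metis
  define d u1 u2 u3 where "d = e' - e" and "u1 = w1 - e" and "u2 = w2 - e" and "u3 = w3 - e"
  note defs = d_def u1_def u2_def u3_def
  have d: "n1 \<bullet> d = 0" "n2 \<bullet> d = 0" "n3 \<bullet> d = 0"
    using edge(2) n1(2) n2(2) n3(2) by (auto simp: defs inner_diff_right)
  have zero: "n1 \<bullet> u1 = 0" "n2 \<bullet> u2 = 0" "n3 \<bullet> u3 = 0"
    using edge(2) n1(2) n2(2) n3(2) w1(1) w2(1) w3(1) by (auto simp: defs inner_diff_right)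
  have mem: "w1 \<in> P" "w2 \<in> P" "w3 \<in> P"
    using n1(2) n2(2) n3(2) w1(1) w2(1) w3(1) by auto
  have "n1 \<bullet> w2 < b1" "n1 \<bullet> w3 < b1" "n2 \<bullet> w1 < b2" "n2 \<bullet> w3 < b2" "n3 \<bullet> w1 < b3" "n3 \<bullet> w2 < b3"
    using mem n1 n2 n3 w1 w2 w3 by (fastforce simp: order.strict_iff_order)+
  then have neg: "n1 \<bullet> u2 < 0" "n1 \<bullet> u3 < 0" "n2 \<bullet> u1 < 0" "n2 \<bullet> u3 < 0" "n3 \<bullet> u1 < 0" "n3 \<bullet> u2 < 0"
    using edge(2) n1(2) n2(2) n3(2) by (auto simp: defs inner_diff_right)
  have u1: "u1 \<notin> span {d}"
    using neg(3) d(2) by (auto simp: span_singleton)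
  have u2: "u2 \<notin> span {u1, d}"
  proof
    assume "u2 \<in> span {u1, d}"
    then obtain r s where "u2 - r *\<^sub>R u1 = s *\<^sub>R d"
      by (auto simp: span_insert[of u1] span_singleton)
    then have "u2 = r *\<^sub>R u1 + s *\<^sub>R d" by (simp add: algebra_simps)
    then show False
      using neg(1) zero(1) d(1) by (simp add: inner_add_right)
  qed
  have "d \<noteq> 0" using edge(1) by (simp add: d_def)
  then have "independent {u2, u1, d}"
    using u1 u2 by (simp add: independent_insert)
  moreover have "card {u2, u1, d} = 3"
    using u1 u2 span_base[of _ "{u1, d}"] span_base[of _ "{d}"] by (auto simp: card_insert_if)
  ultimately have "UNIV \<subseteq> span {u2, u1, d}"
    by (intro card_ge_dim_independent) auto
  then have "u3 \<in> span {u2, u1, d}" by blast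
  then obtain q r s where "u3 - q *\<^sub>R u2 - r *\<^sub>R u1 = s *\<^sub>R d"
    by (auto simp: span_insert[of u2] span_insert[of u1] span_singleton)
  then have u3: "u3 = q *\<^sub>R u2 + r *\<^sub>R u1 + s *\<^sub>R d" by (simp add: algebra_simps)
  \<comment> \<open>Evaluating the first two normals at \<open>u3\<close> isolates one coefficient each.\<close>
  have "q * (n1 \<bullet> u2) < 0" "r * (n2 \<bullet> u1) < 0"
    using neg(2,4) zero(1,2) d by (simp_all add: u3 inner_add_right)
  then have "q > 0" "r > 0"
    using neg(1,3) by (simp_all add: mult_less_0_iff)
  moreover have "q * (n3 \<bullet> u2) + r * (n3 \<bullet> u1) = 0"
    using zero(3) d(3) by (simp add: u3 inner_add_right)
  ultimately show False
    using neg(5,6) by (smt (verit) mult_pos_neg)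
qed

locale monohedral_polyhedron =
  fixes a b c :: "real^3" and P :: "(real^3) set"
  assumes nondegenerate: "\<not> collinear {a, b, c}"
    and monohedral: "monohedral_with (convex hull {a, b, c}) P"
begin

lemma polytope: "polytope P" and aff_dim: "aff_dim P = 3"
  using monohedral aff_dim_nonempty_interior[of P]
  by (auto simp: monohedral_with_def convex_polyhedron_def)

lemma facetE:
  assumes "F facet_of P"
  obtains x y z where "F = convex hull {x, y, z}" "triangle_sides x y z = triangle_sides a b c"
    "\<not> collinear {x, y, z}" "vertices F = {x, y, z}"
proof -
  have "euclidean_congruent F (convex hull {a, b, c})"
    using monohedral assms by (simp add: monohedral_with_def)
  then obtain x y z where xyz: "F = convex hull {x, y, z}" "triangle_sides x y z = triangle_sides a b c"
    by (rule congruent_triangleE)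
  moreover have "\<not> collinear {x, y, z}"
    using noncollinear_triangle_sides[OF xyz(2) nondegenerate] .
  ultimately show ?thesis
    using that vertices_triangle by metis
qed

lemma hull_vertices: "F facet_of P \<Longrightarrow> convex hull (vertices F) = F"
  by (metis facetE)

lemma card_vertices: "F facet_of P \<Longrightarrow> card (vertices F) = 3"
proof -
  assume "F facet_of P"
  then obtain x y z where "\<not> collinear {x, y, z}" "vertices F = {x, y, z}"
    by (rule facetE)
  then show ?thesis
    by (auto simp: card_insert_if insert_commute)
qed

lemma vertices_facet_iff:
  assumes "F facet_of P"
  shows "v \<in> vertices F \<longleftrightarrow> v \<in> vertices P \<and> v \<in> F"
  using extreme_point_of_face[OF facet_of_imp_face_of[OF assms]] by (simp add: vertices_def)

lemma card_facets: "card (vertices ` {F. F facet_of P}) = card {F. F facet_of P}"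
  by (intro card_image inj_onI) (metis hull_vertices mem_Collect_eq)

text \<open>At least two facets pass through an edge, because a proper face of a polyhedron is the intersection of the
  facets containing it, and a single facet is too big. A third facet is excluded above; the
  vertices off the edge serve as the points that separate the facets.\<close>
lemma facets_through_edge:
  assumes F: "F facet_of P" and x: "x \<in> vertices F" and y: "y \<in> vertices F" and "x \<noteq> y"
  shows "card {u \<in> vertices ` {G. G facet_of P}. x \<in> u \<and> y \<in> u} = 2"
proof -
  have P: "polyhedron P" by (simp add: polytope polytope_imp_polyhedron)
  let ?e = "convex hull {x, y}"
  let ?U = "{u \<in> vertices ` {G. G facet_of P}. x \<in> u \<and> y \<in> u}"
  have "finite {G. G facet_of P}" by (rule finite_polytope_facets[OF polytope])
  then have fin: "finite ?U" by simp
  have e: "?e face_of F"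
  proof -
    obtain p q r where pqr: "F = convex hull {p, q, r}" "\<not> collinear {p, q, r}" "vertices F = {p, q, r}"
      by (rule facetE[OF F])
    then have "\<not> affine_dependent {p, q, r}"
      using affine_dependent_imp_collinear_3 by blast
    moreover have "{x, y} \<subseteq> {p, q, r}"
      using pqr(3) x y by simp
    ultimately show ?thesis
      unfolding pqr(1) by (subst face_of_convex_hull_affine_independent) blast+
  qed
  then have "?e face_of P"
    using face_of_trans facet_of_imp_face_of F by blast
  have "aff_dim ?e \<le> 1"
    by (simp add: aff_dim_convex_hull aff_dim_2)
  moreover have "aff_dim F = 2"
    using F aff_dim by (simp add: facet_of_def)
  ultimately have "?e \<noteq> F" "?e \<noteq> P" using aff_dim by auto
  have "?e = \<Inter>{G. G facet_of P \<and> ?e \<subseteq> G}"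
    using face_of_polyhedron[OF P \<open>?e face_of P\<close>] \<open>?e \<noteq> P\<close> by simp
  moreover have "?e \<subseteq> F" using e by (rule face_of_imp_subset)
  ultimately obtain G where G: "G facet_of P" "?e \<subseteq> G" "G \<noteq> F"
    using \<open>?e \<noteq> F\<close> F by blast
  have "x \<in> G" "y \<in> G" using G(2) hull_subset[of "{x, y}" convex] by auto
  then have "x \<in> vertices G" "y \<in> vertices G"
    using x y F G(1) by (simp_all add: vertices_facet_iff)
  moreover have "vertices F \<noteq> vertices G"
    using G F hull_vertices by metis
  ultimately have two: "{vertices F, vertices G} \<subseteq> ?U" "card {vertices F, vertices G} = 2"
    using F G x y by auto
  have "\<not> 3 \<le> card ?U"
  proof
    assume "3 \<le> card ?U"
    then obtain V where V: "V \<subseteq> ?U" "card V = 3"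
      by (rule obtain_subset_with_card_n)
    then obtain u1 u2 u3 where u: "V = {u1, u2, u3}" "u1 \<noteq> u2" "u2 \<noteq> u3" "u1 \<noteq> u3"
      unfolding card_3_iff by blast
    then have "u1 \<in> ?U" "u2 \<in> ?U" "u3 \<in> ?U"
      using V(1) by blast+
    with u(2-) obtain F1 F2 F3 where facets: "F1 facet_of P" "F2 facet_of P" "F3 facet_of P"
      and x: "x \<in> vertices F1" "x \<in> vertices F2" "x \<in> vertices F3"
      and y: "y \<in> vertices F1" "y \<in> vertices F2" "y \<in> vertices F3"
      and ne: "vertices F1 \<noteq> vertices F2" "vertices F2 \<noteq> vertices F3" "vertices F1 \<noteq> vertices F3"
      by auto
    have third: "\<exists>w. vertices F' = {x, y, w} \<and> w \<noteq> x \<and> w \<noteq> y \<and> w \<in> F'"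
      if "F' facet_of P" "x \<in> vertices F'" "y \<in> vertices F'" for F'
    proof -
      have "card (vertices F' - {x, y}) = 1"
        using that card_vertices[OF that(1)] \<open>x \<noteq> y\<close> by (subst card_Diff_subset) auto
      then obtain w where "vertices F' - {x, y} = {w}"
        by (auto simp: card_1_singleton_iff)
      then show ?thesis
        using that vertices_facet_iff[OF that(1)] by blast
    qed
    obtain w1 where w1: "vertices F1 = {x, y, w1}" "w1 \<noteq> x" "w1 \<noteq> y" "w1 \<in> F1"
      using third[OF facets(1) x(1) y(1)] by blast
    obtain w2 where w2: "vertices F2 = {x, y, w2}" "w2 \<noteq> x" "w2 \<noteq> y" "w2 \<in> F2"
      using third[OF facets(2) x(2) y(2)] by blast
    obtain w3 where w3: "vertices F3 = {x, y, w3}" "w3 \<noteq> x" "w3 \<noteq> y" "w3 \<in> F3"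
      using third[OF facets(3) x(3) y(3)] by blast
    have w: "w1 \<noteq> w2" "w2 \<noteq> w3" "w1 \<noteq> w3" using ne w1 w2 w3 by auto
    have "w1 \<in> vertices P" "w2 \<in> vertices P" "w3 \<in> vertices P"
      using vertices_facet_iff[OF facets(1), of w1] vertices_facet_iff[OF facets(2), of w2]
        vertices_facet_iff[OF facets(3), of w3] w1 w2 w3 by auto
    then have "w1 \<notin> F2" "w1 \<notin> F3" "w2 \<notin> F1" "w2 \<notin> F3" "w3 \<notin> F1" "w3 \<notin> F2"
      using vertices_facet_iff[OF facets(1)] vertices_facet_iff[OF facets(2)]
        vertices_facet_iff[OF facets(3)] w1(1-3) w2(1-3) w3(1-3) w by auto
    moreover have "{x, y} \<subseteq> F1 \<inter> F2 \<inter> F3"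
      using vertices_facet_iff facets x y by auto
    ultimately show False
      using no_three_facets_through_edge[OF P facets \<open>x \<noteq> y\<close>] w1(4) w2(4) w3(4) by blast
  qed
  moreover have "2 \<le> card ?U"
    using card_mono[OF fin two(1)] two(2) by simp
  ultimately show ?thesis by simp
qed

sublocale closed_pseudosurface "vertices ` {F. F facet_of P}"
proof
  show "finite (vertices ` {F. F facet_of P})"
    using finite_polytope_facets[OF polytope] by simp
  obtain F where "F facet_of P"
    using polytope_facet_exists[OF polytope] aff_dim by auto
  then show "vertices ` {F. F facet_of P} \<noteq> {}" by auto
qed (use card_vertices facets_through_edge in auto)

lemma face_triangle_sides:
  assumes "{x, y, z} \<in> vertices ` {F. F facet_of P}"
  shows "triangle_sides x y z = triangle_sides a b c"
proof -
  obtain F where F: "F facet_of P" "vertices F = {x, y, z}" using assms by auto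
  obtain p q r where pqr: "triangle_sides p q r = triangle_sides a b c" "vertices F = {p, q, r}"
    by (rule facetE[OF F(1)])
  have "triangle_sides x y z = triangle_sides p q r"
    using F(2) pqr(2) triangle_distinct[OF assms] by (intro triangle_sides_insert_eq) auto
  with pqr(1) show ?thesis by simp
qed

text \<open>A facet is all of \<open>P\<close> in its plane, so a vertex of \<open>P\<close> in that plane is a vertex of the facet.\<close>
lemma apex_not_in_plane:
  assumes "{x, y, z} \<in> vertices ` {F. F facet_of P}" "w \<in> \<Union>(vertices ` {F. F facet_of P})"
    "w \<notin> {x, y, z}"
  shows "w \<notin> affine hull {x, y, z}"
proof
  assume w: "w \<in> affine hull {x, y, z}"
  obtain F where F: "F facet_of P" "vertices F = {x, y, z}" using assms(1) by auto
  have "w \<in> vertices P"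
    using assms(2) vertices_facet_iff by auto
  then have "w \<in> P" by (simp add: vertices_def extreme_point_of_def)
  moreover have "affine hull F = affine hull {x, y, z}"
    using hull_vertices[OF F(1)] F(2) affine_hull_convex_hull by metis
  ultimately have "w \<in> F"
    using face_of_imp_eq_affine_Int[OF polytope_imp_convex[OF polytope] facet_of_imp_face_of[OF F(1)]] w
    by blast
  with \<open>w \<in> vertices P\<close> have "w \<in> vertices F" by (simp add: vertices_facet_iff[OF F(1)])
  with F(2) assms(3) show False by simp
qed

end

section \<open>Lower bounds\<close>

lemma acute_triangle_sides_eq:
  assumes "triangle_sides x y z = triangle_sides a b c" "\<not> collinear {a, b, c}"
  shows "acute_triangle x y z \<longleftrightarrow> acute_triangle a b c"
proof -
  have "\<not> collinear {x, y, z}" by (rule noncollinear_triangle_sides[OF assms])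
  moreover have "{#dist x y, dist y z, dist z x#} = {#dist a b, dist b c, dist c a#}"
    using assms(1) by (simp add: triangle_sides_def)
  ultimately show ?thesis
    unfolding acute_triangle_iff[OF assms(2)] mset_three_eq_iff by (elim disjE) (auto simp: acute_triangle_iff)
qed

text \<open>Squared distances in a form that speaks only of the edge vectors at the apex \<open>v\<close>; the last two
  orders of the endpoints both occur when the edges of a tetrahedron are listed cyclically.\<close>
lemma dist_via_apex:
  fixes v x y :: "'a::real_inner"
  shows "(dist v x)\<^sup>2 = (x - v) \<bullet> (x - v)"
    and "(dist x y)\<^sup>2 = ((x - v) - (y - v)) \<bullet> ((x - v) - (y - v))"
    and "(dist y x)\<^sup>2 = ((x - v) - (y - v)) \<bullet> ((x - v) - (y - v))"
  unfolding dist_commute[of v x] dist_commute[of y x]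
  by (simp_all only: dist_norm power2_norm_eq_inner diff_diff_eq2 diff_add_cancel)

text \<open>With edge vectors \<open>p\<close>, \<open>q\<close>, \<open>r\<close> at \<open>v\<close>, equality of opposite edges makes \<open>p + q - r\<close>
  a vector of squared length \<open>2 (\<bar>p\<bar>\<^sup>2 + \<bar>q\<bar>\<^sup>2 - \<bar>r\<bar>\<^sup>2)\<close>. It vanishes only if \<open>z\<close> completes a
  parallelogram with the other vertices, and likewise for the two other combinations of signs.\<close>
lemma disphenoid_face_acute:
  fixes v x y z :: "real^3"
  assumes "dist v x = dist y z" "dist v y = dist z x" "dist v z = dist x y"
    and noncoplanar: "z \<notin> affine hull {v, x, y}"
    and "\<not> collinear {v, x, y}"
  shows "acute_triangle v x y"
proof -
  define p q r where "p = x - v" and "q = y - v" and "r = z - v"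
  have dists: "(dist v x)\<^sup>2 = p \<bullet> p" "(dist v y)\<^sup>2 = q \<bullet> q" "(dist v z)\<^sup>2 = r \<bullet> r"
    "(dist x y)\<^sup>2 = (p - q) \<bullet> (p - q)" "(dist z x)\<^sup>2 = (p - r) \<bullet> (p - r)"
    "(dist y z)\<^sup>2 = (q - r) \<bullet> (q - r)"
    unfolding p_def q_def r_def by (rule dist_via_apex)+
  have square: "(s - t) \<bullet> (s - t) = s \<bullet> s + t \<bullet> t - 2 * (s \<bullet> t)" for s t :: "real^3"
    by (simp add: inner_diff_left inner_diff_right inner_commute)
  have eq: "p \<bullet> p = q \<bullet> q + r \<bullet> r - 2 * (q \<bullet> r)" "q \<bullet> q = p \<bullet> p + r \<bullet> r - 2 * (p \<bullet> r)"
      "r \<bullet> r = p \<bullet> p + q \<bullet> q - 2 * (p \<bullet> q)"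
    using dists unfolding square assms(1-3) by linarith+
  have hull: "v + s *\<^sub>R p + t *\<^sub>R q \<in> affine hull {v, x, y}" for s t
  proof -
    have "v + s *\<^sub>R p + t *\<^sub>R q = (1 - s - t) *\<^sub>R v + s *\<^sub>R x + t *\<^sub>R y"
      by (simp add: p_def q_def algebra_simps)
    then show ?thesis by (simp only:) (rule mem_affine_3, simp_all add: hull_inc)
  qed
  have "p + q - r = (v + 1 *\<^sub>R p + 1 *\<^sub>R q) - z" "p + r - q = z - (v + (-1) *\<^sub>R p + 1 *\<^sub>R q)"
      "q + r - p = z - (v + 1 *\<^sub>R p + (-1) *\<^sub>R q)"
    by (simp_all add: r_def)
  then have "p + q - r \<noteq> 0" "p + r - q \<noteq> 0" "q + r - p \<noteq> 0"
    using noncoplanar hull by (metis eq_iff_diff_eq_0)+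
  then have "0 < (p + q - r) \<bullet> (p + q - r)" "0 < (p + r - q) \<bullet> (p + r - q)" "0 < (q + r - p) \<bullet> (q + r - p)"
    by simp_all
  moreover have "(s + t - w) \<bullet> (s + t - w) =
      s \<bullet> s + t \<bullet> t + w \<bullet> w + 2 * (s \<bullet> t) - 2 * (s \<bullet> w) - 2 * (t \<bullet> w)" for s t w :: "real^3"
    by (simp add: inner_diff_left inner_diff_right inner_add_left inner_add_right inner_commute)
  ultimately have "r \<bullet> r < p \<bullet> p + q \<bullet> q" "q \<bullet> q < p \<bullet> p + r \<bullet> r" "p \<bullet> p < q \<bullet> q + r \<bullet> r"
    using eq inner_commute[of r q] inner_commute[of r p] inner_commute[of q p] by smt+
  then have "(dist v z)\<^sup>2 < (dist v x)\<^sup>2 + (dist v y)\<^sup>2" "(dist v y)\<^sup>2 < (dist v x)\<^sup>2 + (dist v z)\<^sup>2"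
      "(dist v x)\<^sup>2 < (dist v y)\<^sup>2 + (dist v z)\<^sup>2"
    by (simp_all only: dists)
  then show ?thesis
    unfolding acute_triangle_iff[OF assms(5)] assms(3) dist_commute[of y v] by linarith
qed

text \<open>The sum \<open>p + q + r\<close> of the edge vectors at the apex has squared length \<open>9 l\<^sup>2 - 3 \<beta>\<^sup>2\<close>, and it
  vanishes only if \<open>v\<close> is the centroid of \<open>x y z\<close>.\<close>
lemma equilateral_pyramid_bound:
  fixes v x y z :: "real^3"
  assumes lateral: "dist v x = l" "dist v y = l" "dist v z = l"
    and base: "dist x y = \<beta>" "dist y z = \<beta>" "dist z x = \<beta>"
    and noncoplanar: "z \<notin> affine hull {v, x, y}"
  shows "\<beta> < l * sqrt 3"
proof -
  define p q r where "p = x - v" and "q = y - v" and "r = z - v"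
  have dists: "l\<^sup>2 = p \<bullet> p" "l\<^sup>2 = q \<bullet> q" "l\<^sup>2 = r \<bullet> r"
    "\<beta>\<^sup>2 = (p - q) \<bullet> (p - q)" "\<beta>\<^sup>2 = (p - r) \<bullet> (p - r)" "\<beta>\<^sup>2 = (q - r) \<bullet> (q - r)"
    unfolding p_def q_def r_def using assms dist_via_apex(1)[of v x] dist_via_apex(1)[of v y]
      dist_via_apex(1)[of v z] dist_via_apex(2)[of x y v] dist_via_apex(3)[of z x v] dist_via_apex(2)[of y z v]
    by simp_all
  have "v + (-1) *\<^sub>R p + (-1) *\<^sub>R q \<in> affine hull {v, x, y}"
  proof -
    have "v + (-1) *\<^sub>R p + (-1) *\<^sub>R q = (1 + 1 + 1) *\<^sub>R v + (-1) *\<^sub>R x + (-1) *\<^sub>R y"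
      unfolding scaleR_left_distrib by (simp add: p_def q_def)
    then show ?thesis by (simp only:) (rule mem_affine_3, simp_all add: hull_inc)
  qed
  moreover have "p + q + r = z - (v + (-1) *\<^sub>R p + (-1) *\<^sub>R q)"
    by (simp add: r_def)
  ultimately have "p + q + r \<noteq> 0"
    using noncoplanar by (metis eq_iff_diff_eq_0)
  then have "0 < (p + q + r) \<bullet> (p + q + r)" by simp
  then have "\<beta>\<^sup>2 < 3 * l\<^sup>2"
    using dists by (simp add: inner_diff_left inner_diff_right inner_add_left inner_add_right inner_commute)
  also have "3 * l\<^sup>2 = (l * sqrt 3)\<^sup>2" by (simp add: power_mult_distrib)
  finally show ?thesis
    using lateral(1) by (intro power2_less_imp_less[of \<beta> "l * sqrt 3"]) auto
qed

text \<open>Here \<open>p\<close>, \<open>q\<close>, \<open>r\<close> are the edges at a vertex of degree three, and \<open>s\<close>, \<open>t\<close>, \<open>u\<close> the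
  edges opposite to it, in cyclic order. Cancelling the edge shared by two consecutive faces leaves equations between
  two-element multisets, and their solutions are a tetrahedron with equal opposite edges and a
  pyramid with threefold symmetry.\<close>
lemma corner_sides_cases:
  assumes "{#p, s, q#} = {#q, t, r#}" "{#q, t, r#} = {#r, u, p#}"
  shows "(p = t \<and> q = u \<and> r = s) \<or> (p = q \<and> q = r \<and> s = t \<and> t = u)"
proof -
  have "add_mset q {#p, s#} = add_mset q {#t, r#}" "add_mset r {#q, t#} = add_mset r {#u, p#}"
    using assms by (simp_all add: add_mset_commute)
  then have "{#p, s#} = {#t, r#}" "{#q, t#} = {#u, p#}"
    by simp_all
  then show ?thesis
    unfolding mset_two_eq_iff by auto
qed

context monohedral_polyhedron
begin

text \<open>Some vertex has degree three, which leaves a disphenoid corner or an equilateral pyramid. With at most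
  five facets the base \<open>x y z\<close> is also a facet, so that in the second case base and lateral edges agree
  and the first case applies.\<close>
lemma few_facets_cases:
  assumes "card {F. F facet_of P} \<le> 7"
  shows "acute_triangle a b c \<or> (\<exists>l \<beta>. isosceles_with_sides l \<beta> a b c \<and> \<beta> < l * sqrt 3)"
    and "card {F. F facet_of P} \<le> 5 \<Longrightarrow> acute_triangle a b c"
proof -
  let ?F = "vertices ` {F. F facet_of P}"
  have "card ?F \<le> 7" using assms card_facets by simp
  from exists_vertex_of_degree_at_most_three[OF this] obtain v
    where v: "v \<in> \<Union>?F" "card {t \<in> ?F. v \<in> t} \<le> 3" by blast
  obtain x y z where xyz: "{v, x, y} \<in> ?F" "{v, y, z} \<in> ?F" "{v, z, x} \<in> ?F" and "z \<noteq> x"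
    by (rule degree_three_vertex[OF v])
  note sides = xyz[THEN face_triangle_sides]
  have noncol: "\<not> collinear {v, x, y}"
    using noncollinear_triangle_sides[OF sides(1) nondegenerate] .
  have "z \<noteq> v" "z \<noteq> y" using triangle_distinct[OF xyz(2)] by auto
  then have noncoplanar: "z \<notin> affine hull {v, x, y}"
    using \<open>z \<noteq> x\<close> xyz(2) by (intro apex_not_in_plane[OF xyz(1)]) auto
  have "{#dist v x, dist x y, dist v y#} = {#dist v y, dist y z, dist v z#}"
       "{#dist v y, dist y z, dist v z#} = {#dist v z, dist z x, dist v x#}"
    using sides by (simp_all only: triangle_sides_def dist_commute[of _ v])
  then have cases: "(dist v x = dist y z \<and> dist v y = dist z x \<and> dist v z = dist x y) \<or>
      (dist v x = dist v y \<and> dist v y = dist v z \<and> dist x y = dist y z \<and> dist y z = dist z x)"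
    by (rule corner_sides_cases)
  have acute: "acute_triangle a b c"
    if "dist v x = dist y z" "dist v y = dist z x" "dist v z = dist x y"
    using disphenoid_face_acute[OF that noncoplanar noncol]
      acute_triangle_sides_eq[OF sides(1) nondegenerate] by simp
  from cases show "acute_triangle a b c \<or> (\<exists>l \<beta>. isosceles_with_sides l \<beta> a b c \<and> \<beta> < l * sqrt 3)"
  proof
    assume "dist v x = dist v y \<and> dist v y = dist v z \<and> dist x y = dist y z \<and> dist y z = dist z x"
    then have "dist x y < dist v x * sqrt 3"
      using noncoplanar by (intro equilateral_pyramid_bound[of v x _ y z]) auto
    moreover have "isosceles_with_sides (dist v x) (dist x y) a b c"
      using sides(1)[symmetric] \<open>dist v x = dist v y \<and> _\<close>
      by (simp add: isosceles_with_sides_def triangle_sides_def dist_commute add_mset_commute)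
    ultimately show ?thesis by blast
  next
    assume "dist v x = dist y z \<and> dist v y = dist z x \<and> dist v z = dist x y"
    then show ?thesis
      by (elim conjE) (intro disjI1 acute)
  qed
  show "acute_triangle a b c" if "card {F. F facet_of P} \<le> 5"
  proof -
    have "{x, y, z} \<in> ?F"
      using that by (intro five_triangles_close_up[OF _ xyz]) (simp only: card_facets)
    then have base: "{#dist x y, dist y z, dist z x#} = {#dist v x, dist x y, dist y v#}"
      using face_triangle_sides[of x y z] sides(1) by (simp only: triangle_sides_def)
    from cases show ?thesis
    proof
      assume eq: "dist v x = dist v y \<and> dist v y = dist v z \<and> dist x y = dist y z \<and> dist y z = dist z x"
      then have "dist v x \<in># {#dist x y, dist y z, dist z x#}"
        unfolding base by simp
      with eq have "dist v x = dist x y"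
        by auto
      with eq show ?thesis
        by (intro acute) simp_all
    next
      assume "dist v x = dist y z \<and> dist v y = dist z x \<and> dist v z = dist x y"
      then show ?thesis
        by (elim conjE) (intro acute)
    qed
  qed
qed

lemma at_least_four_facets: "4 \<le> card {F. F facet_of P}"
  using at_least_four card_facets by simp

end

section \<open>Polyhedra given by vertices and polar normals\<close>

text \<open>A polytope with the origin inside is cut out by inequalities \<open>n i \<bullet> x \<le> 1\<close>. Every facet is one of
  the exposed faces \<open>n i \<bullet> x = 1\<close>: a point of its relative interior lies on the boundary and thus satisfies
  some constraint with equality, so the facet is contained in that exposed face, and both have the
  same dimension.\<close>
lemma facets_from_polar_normals:
  fixes S :: "'a::euclidean_space set" and n :: "'i \<Rightarrow> 'a"
  assumes S: "finite S" and I: "finite I"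
    and below: "\<And>i s. i \<in> I \<Longrightarrow> s \<in> S \<Longrightarrow> n i \<bullet> s \<le> 1"
    and inside: "\<And>x. (\<And>i. i \<in> I \<Longrightarrow> n i \<bullet> x \<le> 1) \<Longrightarrow> x \<in> convex hull S"
    and dim: "\<And>i. i \<in> I \<Longrightarrow> aff_dim {s \<in> S. n i \<bullet> s = 1} = int (DIM('a)) - 1"
  shows "interior (convex hull S) \<noteq> {}"
    and "{F. F facet_of convex hull S} = (\<lambda>i. convex hull {s \<in> S. n i \<bullet> s = 1}) ` I"
proof -
  let ?P = "convex hull S"
  have le: "n i \<bullet> x \<le> 1" if "i \<in> I" "x \<in> ?P" for i x
  proof -
    have "?P \<subseteq> {x. n i \<bullet> x \<le> 1}"
      using below that(1) by (intro hull_minimal) (auto simp: convex_halfspace_le)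
    with that(2) show ?thesis by blast
  qed
  have int: "x \<in> interior ?P" if "\<And>i. i \<in> I \<Longrightarrow> n i \<bullet> x < 1" for x
  proof (rule interiorI)
    show "open (\<Inter>i\<in>I. {x. n i \<bullet> x < 1})"
      using I by (intro open_INT) (auto simp: open_halfspace_lt)
    show "x \<in> (\<Inter>i\<in>I. {x. n i \<bullet> x < 1})"
      using that by simp
    show "(\<Inter>i\<in>I. {x. n i \<bullet> x < 1}) \<subseteq> ?P"
      using inside by (auto intro: less_imp_le)
  qed
  then have "0 \<in> interior ?P" by simp
  then show ne: "interior ?P \<noteq> {}" by blast
  then have dimP: "aff_dim ?P = DIM('a)"
    by (rule aff_dim_nonempty_interior)
  have hull: "convex hull {s \<in> S. n i \<bullet> s = 1} = ?P \<inter> {x. n i \<bullet> x = 1}"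
    and face: "(?P \<inter> {x. n i \<bullet> x = 1}) face_of ?P" if "i \<in> I" for i
  proof -
    show face: "(?P \<inter> {x. n i \<bullet> x = 1}) face_of ?P"
      using le that by (intro face_of_Int_supporting_hyperplane_le) auto
    obtain S' where S': "S' \<subseteq> S" "?P \<inter> {x. n i \<bullet> x = 1} = convex hull S'"
      using face_of_convex_hull_subset[OF finite_imp_compact[OF S] face] .
    then have "S' \<subseteq> {s \<in> S. n i \<bullet> s = 1}"
      using hull_subset[of S' convex] by blast
    then have "?P \<inter> {x. n i \<bullet> x = 1} \<subseteq> convex hull {s \<in> S. n i \<bullet> s = 1}"
      unfolding S'(2) by (rule hull_mono)
    moreover have "convex hull {s \<in> S. n i \<bullet> s = 1} \<subseteq> ?P \<inter> {x. n i \<bullet> x = 1}"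
      using hull_subset[of S convex]
      by (intro hull_minimal convex_Int convex_convex_hull convex_hyperplane) auto
    ultimately show "convex hull {s \<in> S. n i \<bullet> s = 1} = ?P \<inter> {x. n i \<bullet> x = 1}" by simp
  qed
  have dim_face: "aff_dim (?P \<inter> {x. n i \<bullet> x = 1}) = int (DIM('a)) - 1" if "i \<in> I" for i
    using dim[OF that] unfolding hull[OF that, symmetric] by (simp add: aff_dim_convex_hull)
  show "{F. F facet_of ?P} = (\<lambda>i. convex hull {s \<in> S. n i \<bullet> s = 1}) ` I"
  proof (intro subset_antisym subsetI)
    fix F assume "F \<in> (\<lambda>i. convex hull {s \<in> S. n i \<bullet> s = 1}) ` I"
    then obtain i where i: "i \<in> I" "F = ?P \<inter> {x. n i \<bullet> x = 1}"
      using hull by auto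
    have "F face_of ?P" "aff_dim F = aff_dim ?P - 1"
      unfolding i(2) dimP using face[OF i(1)] dim_face[OF i(1)] by simp_all
    moreover have "F \<noteq> {}"
    proof
      assume "F = {}"
      then have "aff_dim F = -1" by simp
      with \<open>aff_dim F = aff_dim ?P - 1\<close> dimP show False
        using DIM_positive[where 'a='a] by simp
    qed
    ultimately show "F \<in> {F. F facet_of ?P}"
      by (simp add: facet_of_def)
  next
    fix F assume "F \<in> {F. F facet_of ?P}"
    then have F: "F face_of ?P" "F \<noteq> {}" "aff_dim F = int (DIM('a)) - 1"
      using dimP by (auto simp: facet_of_def)
    then have "rel_interior F \<noteq> {}"
      using rel_interior_eq_empty face_of_imp_convex by blast
    then obtain x where x: "x \<in> rel_interior F" by blast
    then have "x \<in> F" using rel_interior_subset by blast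
    moreover have "F \<noteq> ?P" using F(3) dimP by auto
    ultimately have "x \<notin> interior ?P" "x \<in> ?P"
      using face_of_disjoint_interior[OF F(1)] face_of_imp_subset[OF F(1)] by auto
    from this(1) obtain i where "i \<in> I" "\<not> n i \<bullet> x < 1"
      using int[of x] by (meson)
    then have i: "i \<in> I" "n i \<bullet> x = 1"
      using le[of i x] \<open>x \<in> ?P\<close> by auto
    let ?G = "?P \<inter> {x. n i \<bullet> x = 1}"
    have "F \<subseteq> ?G"
    proof (rule subset_of_face_of[OF face[OF i(1)] face_of_imp_subset[OF F(1)]])
      have "x \<in> ?G" using \<open>x \<in> ?P\<close> i(2) by simp
      with x show "?G \<inter> rel_interior F \<noteq> {}" by blast
    qed
    then have "F face_of ?G"
      by (rule face_of_subset[OF F(1)]) simp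
    then have "F = ?G"
      using face_of_aff_dim_lt[OF face_of_imp_convex[OF face[OF i(1)]], of F] F(3) dim_face[OF i(1)]
      by linarith
    then show "F \<in> (\<lambda>i. convex hull {s \<in> S. n i \<bullet> s = 1}) ` I"
      using i(1) by (simp only: hull[OF i(1), symmetric]) (rule imageI)
  qed
qed

lemma aff_dim_noncollinear:
  fixes x y z :: "'a::euclidean_space"
  assumes "\<not> collinear {x, y, z}"
  shows "aff_dim {x, y, z} = 2"
proof -
  have "card {x, y, z} = 3" using assms by (auto simp: card_insert_if insert_commute)
  moreover have "\<not> affine_dependent {x, y, z}"
    using assms affine_dependent_imp_collinear_3 by blast
  ultimately show ?thesis
    by (simp add: affine_independent_iff_card)
qed

text \<open>The form in which the constructions below are verified: each normal selects a vertex
  triple with the right side lengths, and different normals select different triples.\<close>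
lemma face_countsI:
  fixes S :: "(real^3) set" and n :: "'i \<Rightarrow> real^3"
  assumes nondegenerate: "\<not> collinear {a, b, c}"
    and S: "finite S" and I: "finite I"
    and below: "\<And>i s. i \<in> I \<Longrightarrow> s \<in> S \<Longrightarrow> n i \<bullet> s \<le> 1"
    and inside: "\<And>x. (\<And>i. i \<in> I \<Longrightarrow> n i \<bullet> x \<le> 1) \<Longrightarrow> x \<in> convex hull S"
    and triangle: "\<And>i. i \<in> I \<Longrightarrow>
      \<exists>x y z. {s \<in> S. n i \<bullet> s = 1} = {x, y, z} \<and> triangle_sides x y z = triangle_sides a b c"
    and inj: "inj_on (\<lambda>i. {s \<in> S. n i \<bullet> s = 1}) I"
  shows "card I \<in> face_counts (convex hull {a, b, c})"
proof -
  let ?P = "convex hull S" and ?t = "\<lambda>i. {s \<in> S. n i \<bullet> s = 1}"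
  have noncol: "\<exists>x y z. ?t i = {x, y, z} \<and> triangle_sides x y z = triangle_sides a b c \<and> \<not> collinear {x, y, z}"
    if "i \<in> I" for i
    using triangle[OF that] noncollinear_triangle_sides[OF _ nondegenerate] by blast
  then have dim: "aff_dim (?t i) = int DIM(real^3) - 1" if "i \<in> I" for i
    using that aff_dim_noncollinear by fastforce
  have full_dim: "interior ?P \<noteq> {}" and facets: "{F. F facet_of ?P} = (\<lambda>i. convex hull (?t i)) ` I"
    using facets_from_polar_normals[where n = n, OF S I below inside dim] by simp_all
  have "euclidean_congruent F (convex hull {a, b, c})" if "F facet_of ?P" for F
  proof -
    have "F \<in> (\<lambda>i. convex hull (?t i)) ` I"
      using facets that by blast
    then obtain i where i: "i \<in> I" "F = convex hull (?t i)" by blast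
    obtain x y z where "?t i = {x, y, z}" "triangle_sides x y z = triangle_sides a b c"
      using triangle[OF i(1)] by blast
    then show ?thesis
      using congruent_triangleI i(2) by simp
  qed
  then have "monohedral_with (convex hull {a, b, c}) ?P"
    using full_dim S by (simp add: monohedral_with_def convex_polyhedron_def polytope_convex_hull)
  moreover have "inj_on (\<lambda>i. convex hull (?t i)) I"
  proof (rule inj_onI)
    fix i j assume ij: "i \<in> I" "j \<in> I" "convex hull (?t i) = convex hull (?t j)"
    have vert: "vertices (convex hull (?t k)) = ?t k" if k: "k \<in> I" for k
    proof -
      obtain x y z where "?t k = {x, y, z}" "\<not> collinear {x, y, z}"
        using noncol[OF k] by blast
      then show ?thesis by (simp add: vertices_triangle)
    qed
    have "?t i = vertices (convex hull (?t i))"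
      by (rule vert[OF ij(1), symmetric])
    also have "\<dots> = ?t j"
      unfolding ij(3) by (rule vert[OF ij(2)])
    finally show "i = j"
      by (rule inj_onD[OF inj _ ij(1,2)])
  qed
  then have "card {F. F facet_of ?P} = card I"
    unfolding facets by (rule card_image)
  ultimately show ?thesis
    unfolding face_counts_def mem_Collect_eq by (intro exI[of _ ?P]) simp
qed

section \<open>The polyhedra with eight, six and four faces\<close>

definition pt :: "real \<Rightarrow> real \<Rightarrow> real \<Rightarrow> real^3" where
  "pt x y z = vector [x, y, z]"

lemma pt_cases: obtains x y z where "p = pt x y z"
proof
  show "p = pt (p $ 1) (p $ 2) (p $ 3)"
    by (simp add: pt_def vec_eq_iff forall_3)
qed

lemma pt_simps [simp]:
  "pt x y z = pt x' y' z' \<longleftrightarrow> x = x' \<and> y = y' \<and> z = z'"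
  "pt x y z \<bullet> pt x' y' z' = x * x' + y * y' + z * z'"
  "pt x y z + pt x' y' z' = pt (x + x') (y + y') (z + z')"
  "c *\<^sub>R pt x y z = pt (c * x) (c * y) (c * z)"
  by (auto simp: pt_def vec_eq_iff forall_3 inner_vec_def sum_3)

lemma dist_pt [simp]:
  "dist (pt x y z) (pt x' y' z') = sqrt ((x - x')\<^sup>2 + (y - y')\<^sup>2 + (z - z')\<^sup>2)"
  by (simp add: dist_vec_def L2_set_def sum_3 pt_def dist_real_def)

lemma convex_combination4:
  assumes "convex C" "p \<in> C" "q \<in> C" "r \<in> C" "s \<in> C"
    and "0 \<le> \<alpha>" "0 \<le> \<beta>" "0 \<le> \<gamma>" "0 \<le> \<delta>" "\<alpha> + \<beta> + \<gamma> + \<delta> = 1"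
  shows "\<alpha> *\<^sub>R p + \<beta> *\<^sub>R q + \<gamma> *\<^sub>R r + \<delta> *\<^sub>R s \<in> C"
proof -
  have "(\<Sum>i\<in>{0..<4::nat}. [\<alpha>, \<beta>, \<gamma>, \<delta>] ! i *\<^sub>R [p, q, r, s] ! i) \<in> C"
    using assms by (intro convex_sum) (auto simp: numeral_eq_Suc less_Suc_eq sum.atLeast_Suc_lessThan)
  then show ?thesis
    by (simp add: numeral_eq_Suc add.assoc)
qed

text \<open>An octahedron with apexes at height \<open>h\<close> and \<open>- h\<close>, and an equatorial square of radius \<open>r\<close> whose vertices
  are moved alternately up and down by \<open>k h\<close>. The signs \<open>\<sigma>\<close>, \<open>\<tau>\<close>, \<open>\<upsilon>\<close> select a face: the half of each
  equatorial diagonal and the apex. The zigzag makes the two edges from an apex to the equator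
  unequal, which is what produces obtuse and right faces, and \<open>k < 1\<close> keeps the octahedron
  convex.\<close>
lemma eight_face_scalenohedron:
  assumes nondegenerate: "\<not> collinear {a, b, c}"
    and k: "0 \<le> k" "k < 1" and h: "0 < h" and r: "0 < r"
    and sides: "triangle_sides a b c =
      {#sqrt (r\<^sup>2 + h\<^sup>2 * (1 - k)\<^sup>2), sqrt (2 * r\<^sup>2 + 4 * h\<^sup>2 * k\<^sup>2), sqrt (r\<^sup>2 + h\<^sup>2 * (1 + k)\<^sup>2)#}"
  shows "8 \<in> face_counts (convex hull {a, b, c})"
proof -
  define S where "S = {pt 0 0 h, pt 0 0 (- h), pt r 0 (k * h), pt (- r) 0 (k * h), pt 0 r (- (k * h)), pt 0 (- r) (- (k * h))}"
  define I :: "(real \<times> real \<times> real) set" where "I = {1, -1} \<times> {1, -1} \<times> {1, -1}"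
  define n where "n = (\<lambda>(\<sigma>, \<tau>, \<upsilon>). pt (\<sigma> * (1 - \<upsilon> * k) / r) (\<tau> * (1 + \<upsilon> * k) / r) (\<upsilon> / h))"
  define t where "t = (\<lambda>(\<sigma>, \<tau>, \<upsilon>). {pt 0 0 (\<upsilon> * h), pt (\<sigma> * r) 0 (k * h), pt 0 (\<tau> * r) (- (k * h))})"
  have face: "{s \<in> S. n i \<bullet> s = 1} = t i" if "i \<in> I" for i
    using that k h r by (auto simp: I_def S_def n_def t_def)
  have "card I \<in> face_counts (convex hull {a, b, c})"
  proof (rule face_countsI[OF nondegenerate, where S = S and n = n])
    show "finite S" "finite I" by (simp_all add: S_def I_def)
    show "n i \<bullet> s \<le> 1" if "i \<in> I" "s \<in> S" for i s
      using that k h r by (auto simp: I_def S_def n_def)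
    show "\<exists>x y z. {s \<in> S. n i \<bullet> s = 1} = {x, y, z} \<and> triangle_sides x y z = triangle_sides a b c"
      if "i \<in> I" for i
    proof -
      obtain \<sigma> \<tau> \<upsilon> where i: "i = (\<sigma>, \<tau>, \<upsilon>)" by (cases i)
      have signs: "\<sigma>\<^sup>2 = 1" "\<tau>\<^sup>2 = 1" "\<upsilon> = 1 \<or> \<upsilon> = -1"
        using that by (auto simp: I_def i)
      have "{#sqrt ((\<sigma> * r)\<^sup>2 + (\<upsilon> * h - k * h)\<^sup>2), sqrt ((\<sigma> * r)\<^sup>2 + (\<tau> * r)\<^sup>2 + (k * h + k * h)\<^sup>2),
          sqrt ((\<tau> * r)\<^sup>2 + (\<upsilon> * h + k * h)\<^sup>2)#} = triangle_sides a b c"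
      proof -
        have "(\<sigma> * r)\<^sup>2 = r\<^sup>2" "(\<tau> * r)\<^sup>2 = r\<^sup>2"
          by (simp_all add: power_mult_distrib signs)
        moreover have "(k * h + k * h)\<^sup>2 = 4 * h\<^sup>2 * k\<^sup>2"
          by (simp add: power2_eq_square)
        moreover have "(h - k * h)\<^sup>2 = h\<^sup>2 * (1 - k)\<^sup>2" "(h + k * h)\<^sup>2 = h\<^sup>2 * (1 + k)\<^sup>2"
          "(- h - k * h)\<^sup>2 = h\<^sup>2 * (1 + k)\<^sup>2" "(- h + k * h)\<^sup>2 = h\<^sup>2 * (1 - k)\<^sup>2"
          by (simp_all add: power2_eq_square algebra_simps)
        ultimately show ?thesis
          using signs(3) unfolding sides by (auto simp: add_mset_commute)
      qed
      then show ?thesis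
        unfolding face[OF that]
        by (intro exI[of _ "pt 0 0 (\<upsilon> * h)"] exI[of _ "pt (\<sigma> * r) 0 (k * h)"] exI[of _ "pt 0 (\<tau> * r) (- (k * h))"])
          (simp add: i t_def triangle_sides_def power2_commute)
    qed
    show "inj_on (\<lambda>i. {s \<in> S. n i \<bullet> s = 1}) I"
    proof (rule inj_onI)
      fix i j assume ij: "i \<in> I" "j \<in> I" "{s \<in> S. n i \<bullet> s = 1} = {s \<in> S. n j \<bullet> s = 1}"
      then have t: "t i = t j" by (simp only: face)
      obtain \<sigma> \<tau> \<upsilon> \<sigma>' \<tau>' \<upsilon>' where eq: "i = (\<sigma>, \<tau>, \<upsilon>)" "j = (\<sigma>', \<tau>', \<upsilon>')" by (cases i, cases j)
      have "\<sigma> \<noteq> 0" "\<tau> \<noteq> 0" "\<sigma>' \<noteq> 0" "\<tau>' \<noteq> 0"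
        using ij(1,2) by (auto simp: eq I_def)
      moreover have "pt 0 0 (\<upsilon> * h) \<in> t j" "pt (\<sigma> * r) 0 (k * h) \<in> t j" "pt 0 (\<tau> * r) (- (k * h)) \<in> t j"
        unfolding t[symmetric] by (simp_all add: t_def eq)
      ultimately show "i = j"
        using h r by (simp add: eq t_def)
    qed
    fix x assume x: "\<And>i. i \<in> I \<Longrightarrow> n i \<bullet> x \<le> 1"
    obtain X Y Z where xyz: "x = pt X Y Z" by (rule pt_cases)
    \<comment> \<open>A point is a combination of the equatorial vertices of its quadrant and the two apexes. The weights
      \<open>\<alpha>\<close> and \<open>\<beta>\<close> are forced by the horizontal coordinates; the inequalities of the upper and lower
      face of the quadrant say that the remaining weights of the apexes are nonnegative.\<close>
    define \<sigma> :: real where "\<sigma> = (if 0 \<le> X then 1 else -1)"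
    define \<tau> :: real where "\<tau> = (if 0 \<le> Y then 1 else -1)"
    define \<alpha> where "\<alpha> = \<sigma> * X / r"
    define \<beta> where "\<beta> = \<tau> * Y / r"
    define e where "e = Z / h - \<alpha> * k + \<beta> * k"
    have "\<alpha> \<ge> 0" "\<beta> \<ge> 0"
      using r by (auto simp: \<alpha>_def \<beta>_def \<sigma>_def \<tau>_def)
    have signs: "\<sigma> * \<sigma> = 1" "\<tau> * \<tau> = 1" "\<sigma> \<in> {1, -1}" "\<tau> \<in> {1, -1}"
      by (auto simp: \<sigma>_def \<tau>_def)
    then have "(\<sigma>, \<tau>, 1) \<in> I" "(\<sigma>, \<tau>, -1) \<in> I"
      by (auto simp: I_def)
    then have "\<alpha> * (1 - k) + \<beta> * (1 + k) + Z / h \<le> 1" "\<alpha> * (1 + k) + \<beta> * (1 - k) - Z / h \<le> 1"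
      using x[of "(\<sigma>, \<tau>, 1)"] x[of "(\<sigma>, \<tau>, -1)"]
      by (simp_all add: n_def xyz \<alpha>_def \<beta>_def mult_ac)
    then have e: "0 \<le> (1 - \<alpha> - \<beta> + e) / 2" "0 \<le> (1 - \<alpha> - \<beta> - e) / 2"
      by (simp_all add: e_def algebra_simps)
    have X: "X = \<alpha> * (\<sigma> * r)" and Y: "Y = \<beta> * (\<tau> * r)"
      using r signs(1,2) by (simp_all add: \<alpha>_def \<beta>_def mult_ac)
    have Z: "Z = \<alpha> * (k * h) - \<beta> * (k * h) + e * h"
      using h by (simp add: e_def field_simps)
    have "pt (\<sigma> * r) 0 (k * h) \<in> S" "pt 0 (\<tau> * r) (- (k * h)) \<in> S" "pt 0 0 h \<in> S" "pt 0 0 (- h) \<in> S"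
      using signs(3,4) by (auto simp: S_def)
    then have "\<alpha> *\<^sub>R pt (\<sigma> * r) 0 (k * h) + \<beta> *\<^sub>R pt 0 (\<tau> * r) (- (k * h)) +
        ((1 - \<alpha> - \<beta> + e) / 2) *\<^sub>R pt 0 0 h + ((1 - \<alpha> - \<beta> - e) / 2) *\<^sub>R pt 0 0 (- h) \<in> convex hull S"
      using \<open>\<alpha> \<ge> 0\<close> \<open>\<beta> \<ge> 0\<close> e by (intro convex_combination4) (auto simp: hull_inc field_simps)
    moreover have "\<alpha> * (k * h) - \<beta> * (k * h) + (1 - \<alpha> - \<beta> + e) / 2 * h - (1 - \<alpha> - \<beta> - e) / 2 * h = Z"
      unfolding Z by (simp add: field_simps)
    ultimately show "x \<in> convex hull S"
      by (simp add: xyz X Y)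
  qed
  moreover have "card I = 8" by (simp add: I_def card_cartesian_product)
  ultimately show ?thesis by simp
qed

text \<open>The base has its centroid at the origin, circumradius \<open>2 d\<close> and side \<open>2 e\<close>. The index \<open>j\<close>
  names the base vertex that is missing from a face, and \<open>\<upsilon>\<close> the apex.\<close>
lemma six_face_bipyramid:
  assumes nondegenerate: "\<not> collinear {a, b, c}"
    and d: "0 < d" and e: "0 < e" "e\<^sup>2 = 3 * d\<^sup>2" and h: "0 < h"
    and sides: "triangle_sides a b c = {#sqrt (4 * d\<^sup>2 + h\<^sup>2), sqrt (4 * d\<^sup>2 + h\<^sup>2), 2 * e#}"
  shows "6 \<in> face_counts (convex hull {a, b, c})"
proof -
  define S where "S = {pt 0 0 h, pt 0 0 (- h), pt (2 * d) 0 0, pt (- d) e 0, pt (- d) (- e) 0}"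
  define I :: "(nat \<times> real) set" where "I = {0, 1, 2} \<times> {1, -1}"
  define n where "n = (\<lambda>(j::nat, \<upsilon>).
    pt (if j = 0 then - 1 / d else 1 / (2 * d)) (if j = 0 then 0 else if j = 1 then - 3 / (2 * e) else 3 / (2 * e)) (\<upsilon> / h))"
  define t where "t = (\<lambda>(j::nat, \<upsilon>). {pt 0 0 (\<upsilon> * h),
    if j = 0 then pt (- d) e 0 else pt (2 * d) 0 0, if j = 2 then pt (- d) e 0 else pt (- d) (- e) 0})"
  have face: "{s \<in> S. n i \<bullet> s = 1} = t i" if "i \<in> I" for i
    using that d e h by (auto simp: I_def S_def n_def t_def)
  have "card I \<in> face_counts (convex hull {a, b, c})"
  proof (rule face_countsI[OF nondegenerate, where S = S and n = n])
    show "finite S" "finite I" by (simp_all add: S_def I_def)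
    show "n i \<bullet> s \<le> 1" if "i \<in> I" "s \<in> S" for i s
      using that d e h by (auto simp: I_def S_def n_def)
    show "\<exists>x y z. {s \<in> S. n i \<bullet> s = 1} = {x, y, z} \<and> triangle_sides x y z = triangle_sides a b c"
      if "i \<in> I" for i
    proof -
      obtain j \<upsilon> where i: "i = (j, \<upsilon>)" by (cases i)
      define u where "u = (if j = 0 then pt (- d) e 0 else pt (2 * d) 0 0)"
      define w where "w = (if j = 2 then pt (- d) e 0 else pt (- d) (- e) 0)"
      have "j = 0 \<or> j = 1 \<or> j = 2" and "\<upsilon>\<^sup>2 = 1"
        using that by (auto simp: I_def i)
      have "\<upsilon>\<^sup>2 * h\<^sup>2 = h\<^sup>2" by (simp add: \<open>\<upsilon>\<^sup>2 = 1\<close>)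
      then have "dist (pt 0 0 (\<upsilon> * h)) u = sqrt (4 * d\<^sup>2 + h\<^sup>2)" "dist w (pt 0 0 (\<upsilon> * h)) = sqrt (4 * d\<^sup>2 + h\<^sup>2)"
        by (simp_all add: u_def w_def power_mult_distrib e)
      moreover have "dist u w = sqrt (4 * e\<^sup>2)"
        using \<open>j = 0 \<or> j = 1 \<or> j = 2\<close> by (auto simp: u_def w_def e(2))
      then have "dist u w = 2 * e"
        using e(1) by (simp add: real_sqrt_mult)
      ultimately have "triangle_sides (pt 0 0 (\<upsilon> * h)) u w = triangle_sides a b c"
        unfolding sides by (simp add: triangle_sides_def add_mset_commute)
      then show ?thesis
        unfolding face[OF that] by (intro exI[of _ "pt 0 0 (\<upsilon> * h)"] exI[of _ u] exI[of _ w]) (simp add: i t_def u_def w_def)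
    qed
    show "inj_on (\<lambda>i. {s \<in> S. n i \<bullet> s = 1}) I"
    proof (rule inj_onI)
      fix i j assume ij: "i \<in> I" "j \<in> I" "{s \<in> S. n i \<bullet> s = 1} = {s \<in> S. n j \<bullet> s = 1}"
      then have t: "t i = t j" by (simp only: face)
      obtain k \<upsilon> l \<upsilon>' where eq: "i = (k, \<upsilon>)" "j = (l, \<upsilon>')" by (cases i, cases j)
      have "pt 0 0 (\<upsilon> * h) \<in> t j"
        unfolding t[symmetric] by (simp add: t_def eq)
      then have "\<upsilon> = \<upsilon>'"
        using d e h by (auto simp: eq t_def split: if_splits)
      moreover have "p \<in> t i \<longleftrightarrow> p \<in> t j" for p
        by (simp only: t)
      from this[of "pt (2 * d) 0 0"] this[of "pt (- d) e 0"] have "k = l"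
        using ij(1,2) d e(1) h by (auto simp: eq t_def I_def split: if_splits)
      ultimately show "i = j" by (simp add: eq)
    qed
    fix x assume x: "\<And>i. i \<in> I \<Longrightarrow> n i \<bullet> x \<le> 1"
    obtain X Y Z where xyz: "x = pt X Y Z" by (rule pt_cases)
    \<comment> \<open>The apex on the side of the point gets the weight \<open>\<zeta>\<close>, and a third of it is subtracted from each
      barycentric coordinate of the projection to the base, whose centroid is the projected apex.\<close>
    define \<upsilon> :: real where "\<upsilon> = (if 0 \<le> Z then 1 else -1)"
    define \<zeta> where "\<zeta> = \<upsilon> * Z / h"
    have "\<zeta> \<ge> 0"
      using h by (auto simp: \<zeta>_def \<upsilon>_def)
    have "\<upsilon> * \<upsilon> = 1" "\<upsilon> \<in> {1, -1}"
      by (auto simp: \<upsilon>_def)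
    then have "(0, \<upsilon>) \<in> I" "(1, \<upsilon>) \<in> I" "(2, \<upsilon>) \<in> I"
      by (auto simp: I_def)
    then have "- X / d + \<zeta> \<le> 1" "X / (2 * d) - 3 * Y / (2 * e) + \<zeta> \<le> 1" "X / (2 * d) + 3 * Y / (2 * e) + \<zeta> \<le> 1"
      using x[of "(0, \<upsilon>)"] x[of "(1, \<upsilon>)"] x[of "(2, \<upsilon>)"]
      by (simp_all add: n_def xyz \<zeta>_def)
    then have weights: "0 \<le> (1 + X / d - \<zeta>) / 3" "0 \<le> (1 - X / (2 * d) + 3 * Y / (2 * e) - \<zeta>) / 3"
        "0 \<le> (1 - X / (2 * d) - 3 * Y / (2 * e) - \<zeta>) / 3"
      by simp_all
    have "pt 0 0 (\<upsilon> * h) \<in> S" "pt (2 * d) 0 0 \<in> S" "pt (- d) e 0 \<in> S" "pt (- d) (- e) 0 \<in> S"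
      using \<open>\<upsilon> \<in> {1, -1}\<close> by (auto simp: S_def)
    then have "\<zeta> *\<^sub>R pt 0 0 (\<upsilon> * h) + ((1 + X / d - \<zeta>) / 3) *\<^sub>R pt (2 * d) 0 0 +
        ((1 - X / (2 * d) + 3 * Y / (2 * e) - \<zeta>) / 3) *\<^sub>R pt (- d) e 0 +
        ((1 - X / (2 * d) - 3 * Y / (2 * e) - \<zeta>) / 3) *\<^sub>R pt (- d) (- e) 0 \<in> convex hull S"
      using \<open>\<zeta> \<ge> 0\<close> weights d e(1) by (intro convex_combination4) (auto simp: hull_inc field_simps)
    moreover have "\<zeta> * (\<upsilon> * h) = Z"
      using h \<open>\<upsilon> * \<upsilon> = 1\<close> by (simp add: \<zeta>_def mult_ac)
    moreover have "(1 + X / d - \<zeta>) / 3 * (2 * d) + (1 - X / (2 * d) + 3 * Y / (2 * e) - \<zeta>) / 3 * (- d) +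
        (1 - X / (2 * d) - 3 * Y / (2 * e) - \<zeta>) / 3 * (- d) = X"
      using d e(1) by (simp add: field_simps)
    moreover have "(1 - X / (2 * d) + 3 * Y / (2 * e) - \<zeta>) / 3 * e +
        (1 - X / (2 * d) - 3 * Y / (2 * e) - \<zeta>) / 3 * (- e) = Y"
      using d e(1) by (simp add: field_simps)
    ultimately show "x \<in> convex hull S"
      unfolding xyz by (simp only: pt_simps mult_zero_right add_0_left add_0_right)
  qed
  moreover have "card I = 6" by (simp add: I_def card_cartesian_product)
  ultimately show ?thesis by simp
qed

text \<open>The alternating vertices of the box with half edges \<open>p\<close>, \<open>q\<close>, \<open>r\<close>. The signs \<open>\<sigma>\<close>, \<open>\<tau>\<close> belong
  to the vertex that is missing from a face, and the normal of the face points away from it.\<close>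
lemma four_face_disphenoid:
  assumes nondegenerate: "\<not> collinear {a, b, c}"
    and pqr: "0 < p" "0 < q" "0 < r"
    and sides: "triangle_sides a b c =
      {#2 * sqrt (q\<^sup>2 + r\<^sup>2), 2 * sqrt (p\<^sup>2 + r\<^sup>2), 2 * sqrt (p\<^sup>2 + q\<^sup>2)#}"
  shows "4 \<in> face_counts (convex hull {a, b, c})"
proof -
  define S where "S = {pt p q r, pt p (- q) (- r), pt (- p) q (- r), pt (- p) (- q) r}"
  define I :: "(real \<times> real) set" where "I = {1, -1} \<times> {1, -1}"
  define n where "n = (\<lambda>(\<sigma>, \<tau>). pt (- \<sigma> / p) (- \<tau> / q) (- (\<sigma> * \<tau>) / r))"
  define t where "t = (\<lambda>(\<sigma>, \<tau>). {pt (\<sigma> * p) (- (\<tau> * q)) (- (\<sigma> * \<tau> * r)),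
    pt (- (\<sigma> * p)) (\<tau> * q) (- (\<sigma> * \<tau> * r)), pt (- (\<sigma> * p)) (- (\<tau> * q)) (\<sigma> * \<tau> * r)})"
  have face: "{s \<in> S. n i \<bullet> s = 1} = t i" if "i \<in> I" for i
    using that pqr by (auto simp: I_def S_def n_def t_def)
  have "card I \<in> face_counts (convex hull {a, b, c})"
  proof (rule face_countsI[OF nondegenerate, where S = S and n = n])
    show "finite S" "finite I" by (simp_all add: S_def I_def)
    show "n i \<bullet> s \<le> 1" if "i \<in> I" "s \<in> S" for i s
      using that pqr by (auto simp: I_def S_def n_def)
    show "\<exists>x y z. {s \<in> S. n i \<bullet> s = 1} = {x, y, z} \<and> triangle_sides x y z = triangle_sides a b c"
      if "i \<in> I" for i
    proof -
      obtain \<sigma> \<tau> where i: "i = (\<sigma>, \<tau>)" by (cases i)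
      have signs: "\<sigma>\<^sup>2 = 1" "\<tau>\<^sup>2 = 1"
        using that by (auto simp: I_def i)
      have "(\<sigma> * p)\<^sup>2 = p\<^sup>2" "(\<tau> * q)\<^sup>2 = q\<^sup>2" "(\<sigma> * (\<tau> * r))\<^sup>2 = r\<^sup>2"
        by (simp_all add: power_mult_distrib signs)
      moreover have "(s + s)\<^sup>2 = 4 * s\<^sup>2" "(- s - s)\<^sup>2 = 4 * s\<^sup>2" for s :: real
        by (simp_all add: power2_eq_square algebra_simps)
      moreover have "sqrt (4 * s + 4 * s') = 2 * sqrt (s + s')" for s s'
        using real_sqrt_mult[of 4 "s + s'"] by (simp add: distrib_left)
      ultimately have "triangle_sides (pt (\<sigma> * p) (- (\<tau> * q)) (- (\<sigma> * \<tau> * r)))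
          (pt (- (\<sigma> * p)) (\<tau> * q) (- (\<sigma> * \<tau> * r))) (pt (- (\<sigma> * p)) (- (\<tau> * q)) (\<sigma> * \<tau> * r)) = triangle_sides a b c"
        unfolding sides by (simp add: triangle_sides_def add.commute add_mset_commute)
      then show ?thesis
        unfolding face[OF that] by (simp add: i t_def) blast
    qed
    show "inj_on (\<lambda>i. {s \<in> S. n i \<bullet> s = 1}) I"
    proof (rule inj_onI)
      fix i j assume ij: "i \<in> I" "j \<in> I" "{s \<in> S. n i \<bullet> s = 1} = {s \<in> S. n j \<bullet> s = 1}"
      then have t: "t i = t j" by (simp only: face)
      show "i = j"
      proof (rule ccontr)
        let ?v = "pt (fst j * p) (snd j * q) (fst j * snd j * r)"
        assume "i \<noteq> j"
        then have "?v \<in> t i"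
          using ij(1,2) by (auto simp: t_def I_def)
        moreover have "?v \<notin> t j"
          using ij(2) pqr by (auto simp: t_def I_def)
        ultimately show False by (simp add: t)
      qed
    qed
    fix x assume x: "\<And>i. i \<in> I \<Longrightarrow> n i \<bullet> x \<le> 1"
    obtain X Y Z where xyz: "x = pt X Y Z" by (rule pt_cases)
    define \<alpha> \<beta> \<gamma> where "\<alpha> = X / p" and "\<beta> = Y / q" and "\<gamma> = Z / r"
    have X: "X = \<alpha> * p" and Y: "Y = \<beta> * q" and Z: "Z = \<gamma> * r"
      using pqr by (simp_all add: \<alpha>_def \<beta>_def \<gamma>_def)
    have "0 \<le> (1 + \<alpha> + \<beta> + \<gamma>) / 4" "0 \<le> (1 + \<alpha> - \<beta> - \<gamma>) / 4" "0 \<le> (1 - \<alpha> + \<beta> - \<gamma>) / 4" "0 \<le> (1 - \<alpha> - \<beta> + \<gamma>) / 4"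
      using x[of "(1, 1)"] x[of "(1, -1)"] x[of "(-1, 1)"] x[of "(-1, -1)"]
      by (simp_all add: I_def n_def xyz \<alpha>_def \<beta>_def \<gamma>_def)
    moreover have "pt p q r \<in> S" "pt p (- q) (- r) \<in> S" "pt (- p) q (- r) \<in> S" "pt (- p) (- q) r \<in> S"
      by (auto simp: S_def)
    ultimately have "((1 + \<alpha> + \<beta> + \<gamma>) / 4) *\<^sub>R pt p q r + ((1 + \<alpha> - \<beta> - \<gamma>) / 4) *\<^sub>R pt p (- q) (- r) +
        ((1 - \<alpha> + \<beta> - \<gamma>) / 4) *\<^sub>R pt (- p) q (- r) + ((1 - \<alpha> - \<beta> + \<gamma>) / 4) *\<^sub>R pt (- p) (- q) r \<in> convex hull S"
      by (intro convex_combination4) (auto simp: hull_inc field_simps)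
    moreover have "(1 + \<alpha> + \<beta> + \<gamma>) / 4 * p + (1 + \<alpha> - \<beta> - \<gamma>) / 4 * p + (1 - \<alpha> + \<beta> - \<gamma>) / 4 * (- p) + (1 - \<alpha> - \<beta> + \<gamma>) / 4 * (- p) = X"
      "(1 + \<alpha> + \<beta> + \<gamma>) / 4 * q + (1 + \<alpha> - \<beta> - \<gamma>) / 4 * (- q) + (1 - \<alpha> + \<beta> - \<gamma>) / 4 * q + (1 - \<alpha> - \<beta> + \<gamma>) / 4 * (- q) = Y"
      "(1 + \<alpha> + \<beta> + \<gamma>) / 4 * r + (1 + \<alpha> - \<beta> - \<gamma>) / 4 * (- r) + (1 - \<alpha> + \<beta> - \<gamma>) / 4 * (- r) + (1 - \<alpha> - \<beta> + \<gamma>) / 4 * r = Z"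
      unfolding X Y Z by (simp_all add: field_simps)
    ultimately show "x \<in> convex hull S"
      unfolding xyz by (simp only: pt_simps)
  qed
  moreover have "card I = 4" by (simp add: I_def card_cartesian_product)
  ultimately show ?thesis by simp
qed

section \<open>Solving for the parameters\<close>

text \<open>With squared sides \<open>A\<close>, \<open>C\<close>, \<open>B\<close> of \<open>a b\<close>, \<open>b c\<close>, \<open>c a\<close> and \<open>z = k h\<close> the equations of the scalenohedron are
  \<open>h\<^sup>2 - z\<^sup>2 = u\<close> and \<open>h z = v\<close>, so \<open>h\<^sup>2 + z\<^sup>2 = D\<close>. This gives \<open>H = h\<^sup>2\<close>, and then
  \<open>R = r\<^sup>2\<close>. Since \<open>B\<close> is the largest, \<open>u > 0\<close>, which means \<open>k < 1\<close>, and \<open>v \<ge> 0\<close>;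
  \<open>R > 0\<close> is Heron's formula.\<close>
lemma eight_faces_if_third_side_longest:
  fixes a b c :: "real^3"
  assumes nondegenerate: "\<not> collinear {a, b, c}"
    and longest: "dist a b \<le> dist c a" "dist b c \<le> dist c a"
  shows "8 \<in> face_counts (convex hull {a, b, c})"
proof -
  define A B C where "A = (dist a b)\<^sup>2" and "B = (dist c a)\<^sup>2" and "C = (dist b c)\<^sup>2"
  have "0 < A" using nondegenerate by (auto simp: A_def)
  have "A \<le> B" "C \<le> B"
    using longest by (simp_all add: A_def B_def C_def power_mono)
  have sides: "triangle_sides a b c = {#sqrt A, sqrt C, sqrt B#}"
    by (simp add: triangle_sides_def A_def B_def C_def)
  have "x ^ 4 = (x\<^sup>2)\<^sup>2" for x :: real
    by (simp flip: power_mult)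
  then have heron: "0 < 2 * (A * C + C * B + B * A) - A\<^sup>2 - C\<^sup>2 - B\<^sup>2"
    using collinear_iff_heron[of a b c] nondegenerate
    by (simp add: A_def B_def C_def)
  define u where "u = (A + B - C) / 2"
  define v where "v = (B - A) / 4"
  define D where "D = sqrt (u\<^sup>2 + 4 * v\<^sup>2)"
  define H where "H = (D + u) / 2"
  define R where "R = (A + B) / 2 - D"
  have "0 < u" using \<open>0 < A\<close> \<open>C \<le> B\<close> by (simp add: u_def)
  have "0 \<le> v" using \<open>A \<le> B\<close> by (simp add: v_def)
  have D: "D\<^sup>2 = u\<^sup>2 + 4 * v\<^sup>2" by (simp add: D_def)
  have "0 < D"
    unfolding D_def using \<open>0 < u\<close> by (intro real_sqrt_gt_zero add_pos_nonneg) auto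
  then have "0 < H" using \<open>0 < u\<close> by (simp add: H_def)
  have HZ: "H * ((D - u) / 2) = v\<^sup>2"
    using D by (simp add: H_def power2_eq_square field_simps)
  have "H * ((D - u) / 2) < H * H"
    using \<open>0 < H\<close> \<open>0 < u\<close> by (intro mult_strict_left_mono) (auto simp: H_def)
  then have "v\<^sup>2 < H\<^sup>2"
    unfolding HZ by (simp add: power2_eq_square)
  then have "v < H" using \<open>0 < H\<close> by (simp add: power2_less_imp_less)
  have "(2 * D)\<^sup>2 = 4 * (u\<^sup>2 + 4 * v\<^sup>2)"
    by (simp add: power_mult_distrib D)
  also have "\<dots> < (A + B)\<^sup>2"
    using heron by (simp add: u_def v_def power2_eq_square field_simps)
  finally have "(2 * D)\<^sup>2 < (A + B)\<^sup>2" .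
  then have "2 * D < A + B"
    using \<open>0 < A\<close> \<open>A \<le> B\<close> by (intro power2_less_imp_less[of "2 * D"]) auto
  then have "0 < R" by (simp add: R_def)
  define k where "k = v / H"
  have k: "0 \<le> k" "k < 1"
    using \<open>0 \<le> v\<close> \<open>v < H\<close> \<open>0 < H\<close> by (simp_all add: k_def)
  have Hk: "H * k = v" "H * k\<^sup>2 = (D - u) / 2"
    using HZ \<open>0 < H\<close> by (simp_all add: k_def power2_eq_square field_simps)
  have "R + H * (1 - k)\<^sup>2 = A" "2 * R + 4 * (H * k\<^sup>2) = C" "R + H * (1 + k)\<^sup>2 = B"
  proof -
    have "H * (1 - k)\<^sup>2 = H - 2 * (H * k) + H * k\<^sup>2" "H * (1 + k)\<^sup>2 = H + 2 * (H * k) + H * k\<^sup>2"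
      by (simp_all add: power2_eq_square algebra_simps)
    then show "R + H * (1 - k)\<^sup>2 = A" "2 * R + 4 * (H * k\<^sup>2) = C" "R + H * (1 + k)\<^sup>2 = B"
      unfolding Hk by (simp_all add: R_def H_def u_def v_def field_simps)
  qed
  then have "triangle_sides a b c = {#sqrt ((sqrt R)\<^sup>2 + (sqrt H)\<^sup>2 * (1 - k)\<^sup>2),
      sqrt (2 * (sqrt R)\<^sup>2 + 4 * (sqrt H)\<^sup>2 * k\<^sup>2), sqrt ((sqrt R)\<^sup>2 + (sqrt H)\<^sup>2 * (1 + k)\<^sup>2)#}"
    unfolding sides using \<open>0 < R\<close> \<open>0 < H\<close> by (simp add: mult.assoc)
  then show ?thesis
    using nondegenerate k \<open>0 < R\<close> \<open>0 < H\<close>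
    by (intro eight_face_scalenohedron[of a b c k "sqrt H" "sqrt R"]) simp_all
qed

lemma eight_faces:
  fixes a b c :: "real^3"
  assumes "\<not> collinear {a, b, c}"
  shows "8 \<in> face_counts (convex hull {a, b, c})"
proof -
  consider "dist a b \<le> dist c a" "dist b c \<le> dist c a" | "dist b c \<le> dist a b" "dist c a \<le> dist a b"
    | "dist c a \<le> dist b c" "dist a b \<le> dist b c"
    by linarith
  then show ?thesis
  proof cases
    case 1
    then show ?thesis by (rule eight_faces_if_third_side_longest[OF assms])
  next
    case 2
    have "{b, c, a} = {a, b, c}" by blast
    then show ?thesis
      using eight_faces_if_third_side_longest[of b c a] 2 assms by simp
  next
    case 3
    have "{c, a, b} = {a, b, c}" by blast
    then show ?thesis
      using eight_faces_if_third_side_longest[of c a b] 3 assms by simp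
  qed
qed

lemma isosceles_properties:
  assumes nondegenerate: "\<not> collinear {a, b, c}" and iso: "isosceles_with_sides l \<beta> a b c"
  shows "0 < l" "0 < \<beta>" "\<beta> < 2 * l" "acute_triangle a b c \<longleftrightarrow> \<beta> < l * sqrt 2"
proof -
  have ne: "a \<noteq> b" "b \<noteq> c" "c \<noteq> a" using nondegenerate by (auto simp: insert_commute)
  have "{#dist a b, dist b c, dist c a#} = {#l, l, \<beta>#}"
    using iso by (simp add: isosceles_with_sides_def triangle_sides_def)
  then consider "dist a b = l" "dist b c = l" "dist c a = \<beta>"
    | "dist a b = l" "dist b c = \<beta>" "dist c a = l" | "dist a b = \<beta>" "dist b c = l" "dist c a = l"
    unfolding mset_three_eq_iff by blast
  note cases = this
  have pos: "0 < dist a b" "0 < dist b c" "0 < dist c a"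
    using ne by simp_all
  have "0 < 2 * ((dist a b)\<^sup>2 * (dist b c)\<^sup>2 + (dist b c)\<^sup>2 * (dist c a)\<^sup>2 + (dist c a)\<^sup>2 * (dist a b)\<^sup>2)
      - (dist a b) ^ 4 - (dist b c) ^ 4 - (dist c a) ^ 4"
    using collinear_iff_heron[of a b c] nondegenerate by linarith
  then have heron: "0 < \<beta>\<^sup>2 * (4 * l\<^sup>2 - \<beta>\<^sup>2)"
    by (cases rule: cases) (simp_all only:, simp_all add: power4_eq_xxxx power2_eq_square algebra_simps)
  have "0 < l \<and> 0 < \<beta>"
    using pos by (cases rule: cases) simp_all
  moreover have "acute_triangle a b c \<longleftrightarrow> l\<^sup>2 < l\<^sup>2 + \<beta>\<^sup>2 \<and> \<beta>\<^sup>2 < l\<^sup>2 + l\<^sup>2"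
    unfolding acute_triangle_iff[OF nondegenerate] by (cases rule: cases) auto
  ultimately have facts: "0 < l \<and> 0 < \<beta> \<and> 0 < \<beta>\<^sup>2 * (4 * l\<^sup>2 - \<beta>\<^sup>2) \<and>
      (acute_triangle a b c \<longleftrightarrow> l\<^sup>2 < l\<^sup>2 + \<beta>\<^sup>2 \<and> \<beta>\<^sup>2 < l\<^sup>2 + l\<^sup>2)"
    using heron by simp
  then show pos: "0 < l" "0 < \<beta>" by simp_all
  have "\<beta>\<^sup>2 < (2 * l)\<^sup>2"
    using facts pos by (simp add: zero_less_mult_iff power_mult_distrib)
  then show "\<beta> < 2 * l"
    using pos by (intro power2_less_imp_less[of \<beta>]) auto
  have "l\<^sup>2 + l\<^sup>2 = (l * sqrt 2)\<^sup>2" by (simp add: power_mult_distrib)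
  then have "acute_triangle a b c \<longleftrightarrow> \<beta>\<^sup>2 < (l * sqrt 2)\<^sup>2"
    using facts pos by simp
  also have "\<dots> \<longleftrightarrow> \<beta> < l * sqrt 2"
    using pos power2_less_imp_less[of \<beta> "l * sqrt 2"] power_strict_mono[of \<beta> "l * sqrt 2" 2] by auto
  finally show "acute_triangle a b c \<longleftrightarrow> \<beta> < l * sqrt 2" .
qed

lemma isosceles_sides_unique:
  assumes "isosceles_with_sides l \<beta> a b c" "isosceles_with_sides l' \<beta>' a b c"
  shows "l = l'" "\<beta> = \<beta>'"
proof -
  have "{#l, l, \<beta>#} = {#l', l', \<beta>'#}"
    using assms by (simp add: isosceles_with_sides_def)
  then show "l = l'" "\<beta> = \<beta>'"
    unfolding mset_three_eq_iff by auto
qed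

lemma scalene_iff_not_isosceles:
  "scalene_triangle a b c \<longleftrightarrow> (\<nexists>l \<beta>. isosceles_with_sides l \<beta> a b c)"
proof
  assume scalene: "scalene_triangle a b c"
  show "\<nexists>l \<beta>. isosceles_with_sides l \<beta> a b c"
  proof safe
    fix l \<beta> assume "isosceles_with_sides l \<beta> a b c"
    then have "{#dist a b, dist b c, dist c a#} = {#l, l, \<beta>#}"
      by (simp add: isosceles_with_sides_def triangle_sides_def)
    then show False
      using scalene unfolding mset_three_eq_iff scalene_triangle_def by metis
  qed
next
  assume not: "\<nexists>l \<beta>. isosceles_with_sides l \<beta> a b c"
  have "isosceles_with_sides (dist a b) (dist c a) a b c" if "dist a b = dist b c"
    using that by (simp add: isosceles_with_sides_def triangle_sides_def)
  moreover have "isosceles_with_sides (dist b c) (dist a b) a b c" if "dist b c = dist c a"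
    using that by (simp add: isosceles_with_sides_def triangle_sides_def add_mset_commute)
  moreover have "isosceles_with_sides (dist c a) (dist b c) a b c" if "dist c a = dist a b"
    using that by (simp add: isosceles_with_sides_def triangle_sides_def add_mset_commute)
  ultimately show "scalene_triangle a b c"
    using not unfolding scalene_triangle_def by blast
qed

text \<open>The sides of an acute triangle are the face diagonals of a box: the squared edges of the box
  solve a linear system, and are positive exactly because all angles are acute.\<close>
lemma four_faces_if_acute:
  fixes a b c :: "real^3"
  assumes nondegenerate: "\<not> collinear {a, b, c}" and acute: "acute_triangle a b c"
  shows "4 \<in> face_counts (convex hull {a, b, c})"
proof -
  define A B C where "A = (dist a b)\<^sup>2" and "B = (dist b c)\<^sup>2" and "C = (dist c a)\<^sup>2"
  define p q r where "p = sqrt ((B + C - A) / 8)" and "q = sqrt ((A + C - B) / 8)" and "r = sqrt ((A + B - C) / 8)"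
  have ineqs: "A < B + C" "B < C + A" "C < A + B"
    using acute unfolding acute_triangle_iff[OF nondegenerate] by (simp_all add: A_def B_def C_def)
  then have squares: "q\<^sup>2 + r\<^sup>2 = A / 4" "p\<^sup>2 + r\<^sup>2 = B / 4" "p\<^sup>2 + q\<^sup>2 = C / 4"
    by (simp_all add: p_def q_def r_def field_simps)
  have "triangle_sides a b c =
      {#2 * sqrt (q\<^sup>2 + r\<^sup>2), 2 * sqrt (p\<^sup>2 + r\<^sup>2), 2 * sqrt (p\<^sup>2 + q\<^sup>2)#}"
    unfolding squares by (simp add: A_def B_def C_def real_sqrt_divide triangle_sides_def)
  moreover have "0 < p" "0 < q" "0 < r"
    using ineqs by (simp_all add: p_def q_def r_def)
  ultimately show ?thesis
    using nondegenerate four_face_disphenoid by blast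
qed

lemma six_faces_if_isosceles:
  fixes a b c :: "real^3"
  assumes nondegenerate: "\<not> collinear {a, b, c}"
    and iso: "isosceles_with_sides l \<beta> a b c" and bound: "\<beta> < l * sqrt 3"
  shows "6 \<in> face_counts (convex hull {a, b, c})"
proof -
  note pos = isosceles_properties(1,2)[OF nondegenerate iso]
  define d e h where "d = sqrt (\<beta>\<^sup>2 / 12)" and "e = \<beta> / 2" and "h = sqrt (l\<^sup>2 - \<beta>\<^sup>2 / 3)"
  have "\<beta>\<^sup>2 < (l * sqrt 3)\<^sup>2"
    using bound pos by (intro power_strict_mono) auto
  then have less: "\<beta>\<^sup>2 / 3 < l\<^sup>2" by (simp add: power_mult_distrib)
  then have "4 * d\<^sup>2 + h\<^sup>2 = l\<^sup>2" "e\<^sup>2 = 3 * d\<^sup>2"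
    by (simp_all add: d_def e_def h_def power_divide)
  moreover have "0 < d" "0 < e" "0 < h"
    using pos less by (simp_all add: d_def e_def h_def)
  moreover have "triangle_sides a b c = {#l, l, 2 * e#}"
    using iso by (simp add: isosceles_with_sides_def e_def)
  ultimately show ?thesis
    using nondegenerate pos by (intro six_face_bipyramid[of a b c d e h]) simp_all
qed

theorem theorem2:
  fixes a b c :: "real^3" and T :: "(real^3) set"
  assumes nondegenerate: "\<not> collinear {a, b, c}"
    and T: "T = convex hull {a, b, c}"
  shows "face_counts T \<noteq> {}
    \<and> (acute_triangle a b c \<longrightarrow> min_faces T = 4)
    \<and> (six_face_case a b c \<longrightarrow> min_faces T = 6)
    \<and> (\<not> acute_triangle a b c \<and> \<not> six_face_case a b c \<longrightarrow> min_faces T = 8)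
    \<and> \<not> (acute_triangle a b c \<and> six_face_case a b c)
    \<and> (\<forall>l \<beta>. isosceles_with_sides l \<beta> a b c \<longrightarrow>
          (acute_triangle a b c \<longleftrightarrow> \<beta> < l * sqrt 2))
    \<and> (\<not> acute_triangle a b c \<and> \<not> six_face_case a b c \<longleftrightarrow>
          (right_triangle a b c \<or> obtuse_triangle a b c) \<and> scalene_triangle a b c
          \<or> (\<exists>l \<beta>. isosceles_with_sides l \<beta> a b c \<and> l * sqrt 3 \<le> \<beta> \<and> \<beta> < 2 * l))"
proof -
  note iso = isosceles_properties[OF nondegenerate]
  have count: "\<exists>P. monohedral_polyhedron a b c P \<and> n = card {F. F facet_of P}" if "n \<in> face_counts T" for n
    using that nondegenerate by (auto simp: face_counts_def monohedral_polyhedron_def T)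
  have ge4: "4 \<le> n" if "n \<in> face_counts T" for n
    using count[OF that] monohedral_polyhedron.at_least_four_facets by blast
  have le5: "acute_triangle a b c" if "n \<in> face_counts T" "n \<le> 5" for n
    using count[OF that(1)] monohedral_polyhedron.few_facets_cases(2)[of a b c] that(2) by fastforce
  have le7: "acute_triangle a b c \<or> (\<exists>l \<beta>. isosceles_with_sides l \<beta> a b c \<and> \<beta> < l * sqrt 3)"
    if "n \<in> face_counts T" "n \<le> 7" for n
    using count[OF that(1)] monohedral_polyhedron.few_facets_cases(1)[of a b c] that(2) by blast
  have not_both: "\<not> (acute_triangle a b c \<and> six_face_case a b c)"
    using iso(4) unfolding six_face_case_def by (meson not_le)
  have acute_iff: "acute_triangle a b c \<longleftrightarrow> \<beta> < l * sqrt 2" if "isosceles_with_sides l \<beta> a b c" for l \<beta>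
    using iso(4)[OF that] .
  have nonempty: "face_counts T \<noteq> {}"
    using eight_faces[OF nondegenerate] T by blast
  have four: "min_faces T = 4" if "acute_triangle a b c"
    unfolding min_faces_def using four_faces_if_acute[OF nondegenerate that] ge4
    by (intro Least_equality) (auto simp: T)
  have six: "min_faces T = 6" if six: "six_face_case a b c"
    unfolding min_faces_def
  proof (rule Least_equality)
    show "6 \<in> face_counts T"
      using six six_faces_if_isosceles[OF nondegenerate] by (auto simp: six_face_case_def T)
    show "6 \<le> n" if "n \<in> face_counts T" for n
      using le5[OF that] six not_both by fastforce
  qed
  have eight: "min_faces T = 8" if other: "\<not> acute_triangle a b c" "\<not> six_face_case a b c"
    unfolding min_faces_def
  proof (rule Least_equality)
    show "8 \<in> face_counts T"
      using eight_faces[OF nondegenerate] T by simp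
    show "8 \<le> n" if n: "n \<in> face_counts T" for n
    proof (rule ccontr)
      assume "\<not> 8 \<le> n"
      then obtain l \<beta> where l: "isosceles_with_sides l \<beta> a b c" "\<beta> < l * sqrt 3"
        using le7[OF n] other(1) by auto
      then have "l * sqrt 2 \<le> \<beta>"
        using acute_iff[OF l(1)] other(1) by simp
      with l other(2) show False by (auto simp: six_face_case_def)
    qed
  qed
  have third: "\<not> acute_triangle a b c \<and> \<not> six_face_case a b c \<longleftrightarrow>
          (right_triangle a b c \<or> obtuse_triangle a b c) \<and> scalene_triangle a b c
          \<or> (\<exists>l \<beta>. isosceles_with_sides l \<beta> a b c \<and> l * sqrt 3 \<le> \<beta> \<and> \<beta> < 2 * l)"
  proof (cases "\<exists>l \<beta>. isosceles_with_sides l \<beta> a b c")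
    case True
    then obtain l \<beta> where l: "isosceles_with_sides l \<beta> a b c" by blast
    have unique: "isosceles_with_sides l' \<beta>' a b c \<longleftrightarrow> l' = l \<and> \<beta>' = \<beta>" for l' \<beta>'
      using l isosceles_sides_unique by blast
    have "l * sqrt 2 \<le> l * sqrt 3"
      using iso(1)[OF l] by simp
    moreover have "\<not> scalene_triangle a b c"
      using l by (auto simp: scalene_iff_not_isosceles)
    ultimately show ?thesis
      using iso(3)[OF l] acute_iff[OF l] by (auto simp: six_face_case_def unique)
  next
    case False
    then show ?thesis
      using not_acute_iff_right_or_obtuse[OF nondegenerate]
      by (auto simp: six_face_case_def scalene_iff_not_isosceles)
  qed
  show ?thesis
    using nonempty four six eight not_both acute_iff third by blast
qed

end
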